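(* Let $\mathcal{C}$ be an abelian category, $m\ge1$, and $\mathcal{A},\mathcal{B}\subseteq\mathcal{C}$ classes with $\mathrm{Ext}^1(\mathcal{A},\mathcal{B})=0$, such that $\omega:=\mathcal{A}\cap\mathcal{B}$ is closed under finite coproducts and direct summands. Write $\mathcal{P}:=\pi\mathcal{GP}^{\mathrm{ppr}}_{(\omega,\mathcal{B},m)}$. (1) If $M=N\oplus W$ with $W\in\omega$, then $M\in\mathcal{P}$ if and only if $N\in\mathcal{P}$. (2) The following are equivalent: (a) $\mathcal{P}$ is closed under extensions: for every short exact sequence $0\to X\to Y\to Z\to0$ with $X,Z\in\mathcal{P}$, one has $Y\in\mathcal{P}$; (b) for every short exact sequence $0\to X\to Y\to Z\to0$ with $Y,Z\in\mathcal{P}$, one has $X\in\mathcal{P}$ if and only if $X\in\omega^{\perp_1}$; (c) for every short exact sequence $0\to X\to Y\to Z\to0$ with $X,Y\in\mathcal{P}$, one has $Z\in\mathcal{P}$ if and only if $Z\in{}^{\perp_1}\mathcal{B}$.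
   Context: $\mathrm{Ext}^1(\mathcal{A},\mathcal{B})=0$ means $\mathrm{Ext}^1(A,B)=0$ for all $A\in\mathcal{A}$, $B\in\mathcal{B}$. $\omega^{\perp_1}=\{N:\mathrm{Ext}^1(W,N)=0\ \forall W\in\omega\}$, ${}^{\perp_1}\mathcal{B}=\{N:\mathrm{Ext}^1(N,B)=0\ \forall B\in\mathcal{B}\}$. For a class $\mathcal{X}$, an $\mathcal{X}$-loop at $M$ of length $m$ is an exact chain complex $X_\bullet$ with components in $\mathcal{X}$ and $Z_{km}(X_\bullet)\cong M$ for every $k\in\mathbb{Z}$ ($Z_k$ = $k$-th cycle). $\pi\mathcal{GP}^{\mathrm{ppr}}_{(\mathcal{X},\mathcal{Y},m)}$ (proper $m$-periodic $(\mathcal{X},\mathcal{Y})$-Gorenstein projective objects) is the class of $M$ admitting an $\mathcal{X}$-loop $X_\bullet$ at $M$ of length $m$ which is both $\mathrm{Hom}(\mathcal{X},-)$-acyclic ($\mathrm{Hom}(X,X_\bullet)$ exact for all $X\in\mathcal{X}$) and $\mathrm{Hom}(-,\mathcal{Y})$-acyclic ($\mathrm{Hom}(X_\bullet,Y)$ exact for all $Y\in\mathcal{Y}$). *)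

theory Defs
  imports Main
begin

record ('o, 'm) category =
  c_obj  :: "'o set"
  c_arr  :: "'m set"
  c_dom  :: "'m \<Rightarrow> 'o"
  c_cod  :: "'m \<Rightarrow> 'o"
  c_comp :: "'m \<Rightarrow> 'm \<Rightarrow> 'm"   (* c_comp C g f = g after f *)
  c_id   :: "'o \<Rightarrow> 'm"

definition hom :: "('o,'m) category \<Rightarrow> 'o \<Rightarrow> 'o \<Rightarrow> 'm set" where
  "hom C X Y = {f. f \<in> c_arr C \<and> c_dom C f = X \<and> c_cod C f = Y}"

definition is_category :: "('o,'m) category \<Rightarrow> bool" where
  "is_category C \<longleftrightarrow>
     (\<forall>X\<in>c_obj C. c_id C X \<in> hom C X X) \<and>
     (\<forall>f\<in>c_arr C. c_dom C f \<in> c_obj C \<and> c_cod C f \<in> c_obj C) \<and>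
     (\<forall>f g. f \<in> c_arr C \<and> g \<in> c_arr C \<and> c_cod C f = c_dom C g
        \<longrightarrow> c_comp C g f \<in> hom C (c_dom C f) (c_cod C g)) \<and>
     (\<forall>f\<in>c_arr C. c_comp C f (c_id C (c_dom C f)) = f \<and> c_comp C (c_id C (c_cod C f)) f = f) \<and>
     (\<forall>f g h. f \<in> c_arr C \<and> g \<in> c_arr C \<and> h \<in> c_arr C \<and>
        c_cod C f = c_dom C g \<and> c_cod C g = c_dom C h
        \<longrightarrow> c_comp C h (c_comp C g f) = c_comp C (c_comp C h g) f)"

definition zero_obj :: "('o,'m) category \<Rightarrow> 'o \<Rightarrow> bool" where
  "zero_obj C Z \<longleftrightarrow> Z \<in> c_obj C \<and>
     (\<forall>X\<in>c_obj C. (\<exists>!f. f \<in> hom C Z X) \<and> (\<exists>!f. f \<in> hom C X Z))"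

definition zero_mor :: "('o,'m) category \<Rightarrow> 'm \<Rightarrow> bool" where
  "zero_mor C h \<longleftrightarrow> h \<in> c_arr C \<and>
     (\<exists>Z g1 g2. zero_obj C Z \<and> g1 \<in> hom C (c_dom C h) Z \<and> g2 \<in> hom C Z (c_cod C h)
        \<and> h = c_comp C g2 g1)"

definition mono :: "('o,'m) category \<Rightarrow> 'm \<Rightarrow> bool" where
  "mono C f \<longleftrightarrow> f \<in> c_arr C \<and>
     (\<forall>g h. g \<in> c_arr C \<and> h \<in> c_arr C \<and> c_cod C g = c_dom C f \<and> c_cod C h = c_dom C f
        \<and> c_dom C g = c_dom C h \<and> c_comp C f g = c_comp C f h \<longrightarrow> g = h)"

definition epi :: "('o,'m) category \<Rightarrow> 'm \<Rightarrow> bool" where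
  "epi C f \<longleftrightarrow> f \<in> c_arr C \<and>
     (\<forall>g h. g \<in> c_arr C \<and> h \<in> c_arr C \<and> c_dom C g = c_cod C f \<and> c_dom C h = c_cod C f
        \<and> c_cod C g = c_cod C h \<and> c_comp C g f = c_comp C h f \<longrightarrow> g = h)"

definition iso_mor :: "('o,'m) category \<Rightarrow> 'm \<Rightarrow> bool" where
  "iso_mor C f \<longleftrightarrow> f \<in> c_arr C \<and>
     (\<exists>g\<in>hom C (c_cod C f) (c_dom C f).
        c_comp C g f = c_id C (c_dom C f) \<and> c_comp C f g = c_id C (c_cod C f))"

definition isomorphic :: "('o,'m) category \<Rightarrow> 'o \<Rightarrow> 'o \<Rightarrow> bool" where
  "isomorphic C X Y \<longleftrightarrow> (\<exists>f\<in>hom C X Y. iso_mor C f)"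

definition is_product :: "('o,'m) category \<Rightarrow> 'o \<Rightarrow> 'o \<Rightarrow> 'o \<Rightarrow> 'm \<Rightarrow> 'm \<Rightarrow> bool" where
  "is_product C A B P p q \<longleftrightarrow> P \<in> c_obj C \<and> p \<in> hom C P A \<and> q \<in> hom C P B \<and>
     (\<forall>T f g. f \<in> hom C T A \<and> g \<in> hom C T B \<longrightarrow>
        (\<exists>!u. u \<in> hom C T P \<and> c_comp C p u = f \<and> c_comp C q u = g))"

definition is_coproduct :: "('o,'m) category \<Rightarrow> 'o \<Rightarrow> 'o \<Rightarrow> 'o \<Rightarrow> 'm \<Rightarrow> 'm \<Rightarrow> bool" where
  "is_coproduct C A B S i j \<longleftrightarrow> S \<in> c_obj C \<and> i \<in> hom C A S \<and> j \<in> hom C B S \<and>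
     (\<forall>T f g. f \<in> hom C A T \<and> g \<in> hom C B T \<longrightarrow>
        (\<exists>!u. u \<in> hom C S T \<and> c_comp C u i = f \<and> c_comp C u j = g))"

definition is_kernel :: "('o,'m) category \<Rightarrow> 'm \<Rightarrow> 'm \<Rightarrow> bool" where
  "is_kernel C f k \<longleftrightarrow> f \<in> c_arr C \<and> k \<in> c_arr C \<and> c_cod C k = c_dom C f \<and>
     zero_mor C (c_comp C f k) \<and>
     (\<forall>g. g \<in> c_arr C \<and> c_cod C g = c_dom C f \<and> zero_mor C (c_comp C f g) \<longrightarrow>
        (\<exists>!u. u \<in> hom C (c_dom C g) (c_dom C k) \<and> c_comp C k u = g))"

definition is_cokernel :: "('o,'m) category \<Rightarrow> 'm \<Rightarrow> 'm \<Rightarrow> bool" where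
  "is_cokernel C f c \<longleftrightarrow> f \<in> c_arr C \<and> c \<in> c_arr C \<and> c_dom C c = c_cod C f \<and>
     zero_mor C (c_comp C c f) \<and>
     (\<forall>g. g \<in> c_arr C \<and> c_dom C g = c_cod C f \<and> zero_mor C (c_comp C g f) \<longrightarrow>
        (\<exists>!u. u \<in> hom C (c_cod C c) (c_cod C g) \<and> c_comp C u c = g))"

text \<open>Abelian category (Freyd's axioms): zero object, binary products and coproducts,
  kernels and cokernels, every mono is a kernel and every epi is a cokernel.\<close>
definition abelian :: "('o,'m) category \<Rightarrow> bool" where
  "abelian C \<longleftrightarrow> is_category C \<and> (\<exists>Z. zero_obj C Z) \<and>
     (\<forall>A\<in>c_obj C. \<forall>B\<in>c_obj C. (\<exists>P p q. is_product C A B P p q) \<and> (\<exists>S i j. is_coproduct C A B S i j)) \<and>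
     (\<forall>f\<in>c_arr C. (\<exists>k. is_kernel C f k) \<and> (\<exists>c. is_cokernel C f c)) \<and>
     (\<forall>f. mono C f \<longrightarrow> (\<exists>g. is_kernel C g f)) \<and>
     (\<forall>f. epi C f \<longrightarrow> (\<exists>g. is_cokernel C g f))"

text \<open>A --f--> B --g--> D is exact at B: g f = 0 and the induced map from A to the kernel of g is epi
  (i.e. image f = kernel g).\<close>
definition exact_at :: "('o,'m) category \<Rightarrow> 'm \<Rightarrow> 'm \<Rightarrow> bool" where
  "exact_at C f g \<longleftrightarrow> f \<in> c_arr C \<and> g \<in> c_arr C \<and> c_cod C f = c_dom C g \<and>
     zero_mor C (c_comp C g f) \<and>
     (\<exists>k u. is_kernel C g k \<and> u \<in> hom C (c_dom C f) (c_dom C k) \<and> c_comp C k u = f \<and> epi C u)"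

definition short_exact :: "('o,'m) category \<Rightarrow> 'o \<Rightarrow> 'o \<Rightarrow> 'o \<Rightarrow> 'm \<Rightarrow> 'm \<Rightarrow> bool" where
  "short_exact C X Y Z f g \<longleftrightarrow> f \<in> hom C X Y \<and> g \<in> hom C Y Z \<and>
     mono C f \<and> epi C g \<and> exact_at C f g"

text \<open>Ext^1(A,B) = 0 (Yoneda): every extension 0 \<rightarrow> B \<rightarrow> E \<rightarrow> A \<rightarrow> 0 splits.\<close>
definition Ext1_zero :: "('o,'m) category \<Rightarrow> 'o \<Rightarrow> 'o \<Rightarrow> bool" where
  "Ext1_zero C A B \<longleftrightarrow>
     (\<forall>E f g. short_exact C B E A f g \<longrightarrow> (\<exists>r\<in>hom C E B. c_comp C r f = c_id C B))"

definition Ext1_zero_classes :: "('o,'m) category \<Rightarrow> 'o set \<Rightarrow> 'o set \<Rightarrow> bool" where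
  "Ext1_zero_classes C \<A> \<B> \<longleftrightarrow> (\<forall>A\<in>\<A>. \<forall>B\<in>\<B>. Ext1_zero C A B)"

definition right_perp1 :: "('o,'m) category \<Rightarrow> 'o set \<Rightarrow> 'o set" where
  "right_perp1 C \<W> = {N \<in> c_obj C. \<forall>W\<in>\<W>. Ext1_zero C W N}"

definition left_perp1 :: "('o,'m) category \<Rightarrow> 'o set \<Rightarrow> 'o set" where
  "left_perp1 C \<B> = {N \<in> c_obj C. \<forall>B\<in>\<B>. Ext1_zero C N B}"

definition chain_complex :: "('o,'m) category \<Rightarrow> (int \<Rightarrow> 'o) \<Rightarrow> (int \<Rightarrow> 'm) \<Rightarrow> bool" where
  "chain_complex C X d \<longleftrightarrow> (\<forall>n. X n \<in> c_obj C \<and> d n \<in> hom C (X n) (X (n - 1)) \<and>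
      zero_mor C (c_comp C (d (n - 1)) (d n)))"

definition exact_complex :: "('o,'m) category \<Rightarrow> (int \<Rightarrow> 'o) \<Rightarrow> (int \<Rightarrow> 'm) \<Rightarrow> bool" where
  "exact_complex C X d \<longleftrightarrow> chain_complex C X d \<and> (\<forall>n. exact_at C (d (n + 1)) (d n))"

definition cycle_iso :: "('o,'m) category \<Rightarrow> (int \<Rightarrow> 'o) \<Rightarrow> (int \<Rightarrow> 'm) \<Rightarrow> int \<Rightarrow> 'o \<Rightarrow> bool" where
  "cycle_iso C X d n M \<longleftrightarrow> (\<exists>k. is_kernel C (d n) k \<and> isomorphic C (c_dom C k) M)"

definition hom_from_acyclic :: "('o,'m) category \<Rightarrow> 'o \<Rightarrow> (int \<Rightarrow> 'o) \<Rightarrow> (int \<Rightarrow> 'm) \<Rightarrow> bool" where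
  "hom_from_acyclic C W X d \<longleftrightarrow> (\<forall>n. \<forall>f\<in>hom C W (X n). zero_mor C (c_comp C (d n) f) \<longrightarrow>
      (\<exists>g\<in>hom C W (X (n + 1)). c_comp C (d (n + 1)) g = f))"

definition hom_to_acyclic :: "('o,'m) category \<Rightarrow> 'o \<Rightarrow> (int \<Rightarrow> 'o) \<Rightarrow> (int \<Rightarrow> 'm) \<Rightarrow> bool" where
  "hom_to_acyclic C Y X d \<longleftrightarrow> (\<forall>n. \<forall>f\<in>hom C (X n) Y. zero_mor C (c_comp C f (d (n + 1))) \<longrightarrow>
      (\<exists>g\<in>hom C (X (n - 1)) Y. c_comp C g (d n) = f))"

definition is_loop :: "('o,'m) category \<Rightarrow> 'o set \<Rightarrow> nat \<Rightarrow> 'o \<Rightarrow> (int \<Rightarrow> 'o) \<Rightarrow> (int \<Rightarrow> 'm) \<Rightarrow> bool" where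
  "is_loop C \<X> m M X d \<longleftrightarrow> exact_complex C X d \<and> (\<forall>n. X n \<in> \<X>) \<and>
     (\<forall>k::int. cycle_iso C X d (k * int m) M)"

definition piGP_ppr :: "('o,'m) category \<Rightarrow> 'o set \<Rightarrow> 'o set \<Rightarrow> nat \<Rightarrow> 'o set" where
  "piGP_ppr C \<X> \<Y> m = {M \<in> c_obj C. \<exists>X d. is_loop C \<X> m M X d \<and>
      (\<forall>W\<in>\<X>. hom_from_acyclic C W X d) \<and> (\<forall>Y\<in>\<Y>. hom_to_acyclic C Y X d)}"

definition closed_fin_coproducts :: "('o,'m) category \<Rightarrow> 'o set \<Rightarrow> bool" where
  "closed_fin_coproducts C \<W> \<longleftrightarrow> (\<forall>Z. zero_obj C Z \<longrightarrow> Z \<in> \<W>) \<and>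
     (\<forall>A B S i j. A \<in> \<W> \<and> B \<in> \<W> \<and> is_coproduct C A B S i j \<longrightarrow> S \<in> \<W>)"

definition closed_summands :: "('o,'m) category \<Rightarrow> 'o set \<Rightarrow> bool" where
  "closed_summands C \<W> \<longleftrightarrow>
     (\<forall>A B S i j. S \<in> \<W> \<and> A \<in> c_obj C \<and> B \<in> c_obj C \<and> is_coproduct C A B S i j \<longrightarrow> A \<in> \<W> \<and> B \<in> \<W>)"

end

theory Submission
  imports Defs
begin

text \<open>Cutting a proper loop at its cycles shows that \<open>M\<close> lies in \<open>\<P>\<close> iff \<open>M\<close> is an
  \<open>m\<close>-periodic point of the relation relating \<open>K\<close> to \<open>M\<close> when there is a short exact sequence
  \<open>0 \<rightarrow> K \<rightarrow> W \<rightarrow> M \<rightarrow> 0\<close> with \<open>W \<in> \<omega>\<close> and both ends in \<open>\<omega>\<^sup>\<bottom> \<inter> \<^sup>\<bottom>\<B>\<close>. The Ext-vanishing makes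
  summands from \<open>\<omega>\<close> split off or adjoinable at either end of such a sequence, which gives (1).
  For (2), the pullback of a sequence \<open>0 \<rightarrow> X \<rightarrow> Y \<rightarrow> Z \<rightarrow> 0\<close> along \<open>0 \<rightarrow> N \<rightarrow> W \<rightarrow> Z \<rightarrow> 0\<close> has the form
  \<open>X \<oplus> W\<close> and is an extension of \<open>Y\<close> by \<open>N\<close>; pushouts are dual. No step needs the addition of
  morphisms, so everything is derived directly from Freyd's axioms.\<close>


section \<open>The opposite category\<close>

definition op_cat :: "('o,'m) category \<Rightarrow> ('o,'m) category" where
  "op_cat C = \<lparr>c_obj = c_obj C, c_arr = c_arr C, c_dom = c_cod C, c_cod = c_dom C,
     c_comp = (\<lambda>g f. c_comp C f g), c_id = c_id C\<rparr>"

lemma op_cat_sel [simp]: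
  "c_obj (op_cat C) = c_obj C" "c_arr (op_cat C) = c_arr C"
  "c_dom (op_cat C) = c_cod C" "c_cod (op_cat C) = c_dom C"
  "c_comp (op_cat C) g f = c_comp C f g" "c_id (op_cat C) = c_id C"
  by (simp_all add: op_cat_def)

lemma hom_op_cat [simp]: "hom (op_cat C) X Y = hom C Y X"
  by (auto simp: hom_def)

lemma is_category_op_cat: "is_category C \<Longrightarrow> is_category (op_cat C)"
  by (simp add: is_category_def hom_def)

lemma zero_obj_op_cat [simp]: "zero_obj (op_cat C) = zero_obj C"
  by (auto simp: zero_obj_def fun_eq_iff)

lemma zero_mor_op_cat [simp]: "zero_mor (op_cat C) = zero_mor C"
  by (auto simp: zero_mor_def fun_eq_iff)

lemma mono_op_cat [simp]: "mono (op_cat C) = epi C"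
  by (auto simp: mono_def epi_def fun_eq_iff)

lemma epi_op_cat [simp]: "epi (op_cat C) = mono C"
  by (auto simp: mono_def epi_def fun_eq_iff)

lemma is_product_op_cat [simp]: "is_product (op_cat C) = is_coproduct C"
  by (simp add: is_product_def is_coproduct_def fun_eq_iff)

lemma is_coproduct_op_cat [simp]: "is_coproduct (op_cat C) = is_product C"
  by (simp add: is_product_def is_coproduct_def fun_eq_iff)

lemma is_kernel_op_cat [simp]: "is_kernel (op_cat C) = is_cokernel C"
  by (simp add: is_kernel_def is_cokernel_def fun_eq_iff)

lemma is_cokernel_op_cat [simp]: "is_cokernel (op_cat C) = is_kernel C"
  by (simp add: is_kernel_def is_cokernel_def fun_eq_iff)

lemma abelian_op_cat: "abelian C \<Longrightarrow> abelian (op_cat C)"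
  by (simp add: abelian_def is_category_op_cat)

definition zero_map :: "('o,'m) category \<Rightarrow> 'o \<Rightarrow> 'o \<Rightarrow> 'm" where
  "zero_map C X Y = (THE f. f \<in> hom C X Y \<and> zero_mor C f)"

lemma zero_map_op_cat [simp]: "zero_map (op_cat C) X Y = zero_map C Y X"
  by (simp add: zero_map_def)


section \<open>Elementary theory of abelian categories\<close>

locale abelian_category =
  fixes C :: "('o,'m) category"
  assumes abelian: "abelian C"
begin

abbreviation comp (infixr "\<cdot>" 70) where "g \<cdot> f \<equiv> c_comp C g f"
abbreviation ident ("\<one>") where "\<one> \<equiv> c_id C"
abbreviation zero ("\<zero>") where "\<zero> \<equiv> zero_map C"
abbreviation Hom where "Hom \<equiv> hom C"

lemma dual: "abelian_category (op_cat C)"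
  by (simp add: abelian_category_def abelian abelian_op_cat)

lemma is_category: "is_category C"
  using abelian by (simp add: abelian_def)


subsection \<open>Composition\<close>

text \<open>The object memberships are redundant on the right; they are there because the simplifier,
  when it unfolds an assumption \<open>f \<in> Hom X Y\<close>, should learn that \<open>X\<close> and \<open>Y\<close> are objects.\<close>

lemma in_hom_iff [simp]:
  "f \<in> Hom X Y \<longleftrightarrow> X \<in> c_obj C \<and> Y \<in> c_obj C \<and> f \<in> c_arr C \<and> c_dom C f = X \<and> c_cod C f = Y"
  using is_category by (auto simp: hom_def is_category_def)

lemma dom_in_obj [simp]: "f \<in> c_arr C \<Longrightarrow> c_dom C f \<in> c_obj C"
  and cod_in_obj [simp]: "f \<in> c_arr C \<Longrightarrow> c_cod C f \<in> c_obj C"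
  using is_category by (auto simp: is_category_def)

lemma id_in_hom [simp]:
  assumes "X \<in> c_obj C"
  shows "\<one> X \<in> c_arr C" "c_dom C (\<one> X) = X" "c_cod C (\<one> X) = X"
  using is_category assms by (auto simp: is_category_def hom_def)

lemma comp_in_hom [simp]:
  assumes "f \<in> c_arr C" "g \<in> c_arr C" "c_cod C f = c_dom C g"
  shows "g \<cdot> f \<in> c_arr C" "c_dom C (g \<cdot> f) = c_dom C f" "c_cod C (g \<cdot> f) = c_cod C g"
  using is_category assms unfolding is_category_def hom_def by auto

lemma comp_id [simp]: "f \<in> c_arr C \<Longrightarrow> c_dom C f = X \<Longrightarrow> f \<cdot> \<one> X = f"
  and id_comp [simp]: "f \<in> c_arr C \<Longrightarrow> c_cod C f = Y \<Longrightarrow> \<one> Y \<cdot> f = f"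
  using is_category by (auto simp: is_category_def)

lemma comp_assoc [simp]:
  assumes "f \<in> c_arr C" "g \<in> c_arr C" "h \<in> c_arr C" "c_cod C f = c_dom C g" "c_cod C g = c_dom C h"
  shows "(h \<cdot> g) \<cdot> f = h \<cdot> g \<cdot> f"
proof -
  have "\<forall>f g h. f \<in> c_arr C \<and> g \<in> c_arr C \<and> h \<in> c_arr C \<and>
      c_cod C f = c_dom C g \<and> c_cod C g = c_dom C h \<longrightarrow> h \<cdot> g \<cdot> f = (h \<cdot> g) \<cdot> f"
    using is_category unfolding is_category_def by (elim conjE)
  then show ?thesis using assms by simp
qed

text \<open>Nesting composites to the right hides the left-hand side of an equation \<open>g \<cdot> f = h\<close> inside a
  longer composite; this form of the equation still applies there.\<close>

lemma comp_reduce: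
  assumes "g \<cdot> f = h" "f \<in> c_arr C" "g \<in> c_arr C" "t \<in> c_arr C" "c_cod C f = c_dom C g"
    "c_cod C t = c_dom C f"
  shows "g \<cdot> f \<cdot> t = h \<cdot> t"
  using assms comp_assoc[of t f g] by simp


subsection \<open>Zero morphisms\<close>

lemma zero_obj_ex: obtains Z where "zero_obj C Z"
  using abelian by (auto simp: abelian_def)

lemma zero_obj_initial:
  assumes "zero_obj C Z" "X \<in> c_obj C"
  shows "\<exists>!f. f \<in> Hom Z X"
  using assms by (simp add: zero_obj_def del: in_hom_iff)

lemma zero_obj_terminal:
  assumes "zero_obj C Z" "X \<in> c_obj C"
  shows "\<exists>!f. f \<in> Hom X Z"
  using assms by (simp add: zero_obj_def del: in_hom_iff)

lemma zero_morI:
  assumes "zero_obj C Z" "f \<in> Hom X Z" "g \<in> Hom Z Y"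
  shows "zero_mor C (g \<cdot> f)"
  unfolding zero_mor_def using assms by auto

lemma zero_morE:
  assumes "zero_mor C h" "h \<in> Hom X Y"
  obtains Z f g where "zero_obj C Z" "f \<in> Hom X Z" "g \<in> Hom Z Y" "h = g \<cdot> f"
  using assms unfolding zero_mor_def by auto

lemma zero_mor_unique:
  assumes "zero_mor C h" "zero_mor C h'" "h \<in> Hom X Y" "h' \<in> Hom X Y"
  shows "h = h'"
proof -
  obtain Z f g where h: "zero_obj C Z" "f \<in> Hom X Z" "g \<in> Hom Z Y" "h = g \<cdot> f"
    using zero_morE[OF assms(1,3)] .
  obtain Z' f' g' where h': "zero_obj C Z'" "f' \<in> Hom X Z'" "g' \<in> Hom Z' Y" "h' = g' \<cdot> f'"
    using zero_morE[OF assms(2,4)] .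
  have obj: "X \<in> c_obj C" "Y \<in> c_obj C" "Z' \<in> c_obj C"
    using assms(3) h'(2) by auto
  obtain z where z: "z \<in> Hom Z Z'" using zero_obj_initial[OF h(1) obj(3)] by blast
  have "z \<cdot> f \<in> Hom X Z'" "g' \<cdot> z \<in> Hom Z Y" using h h' z by auto
  then have "z \<cdot> f = f'" "g' \<cdot> z = g"
    using zero_obj_terminal[OF h'(1) obj(1)] zero_obj_initial[OF h(1) obj(2)] h h' by metis+
  then show ?thesis
    using h h' z comp_reduce[of g' z g f] by auto
qed

lemma zero_map_zero_mor:
  assumes "X \<in> c_obj C" "Y \<in> c_obj C"
  shows "\<zero> X Y \<in> Hom X Y \<and> zero_mor C (\<zero> X Y)"
proof -
  obtain Z where Z: "zero_obj C Z" by (rule zero_obj_ex)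
  obtain f where f: "f \<in> Hom X Z" using zero_obj_terminal[OF Z assms(1)] by blast
  obtain g where g: "g \<in> Hom Z Y" using zero_obj_initial[OF Z assms(2)] by blast
  have "g \<cdot> f \<in> Hom X Y" "zero_mor C (g \<cdot> f)"
    using f g zero_morI[OF Z f g] by auto
  then have "\<exists>!h. h \<in> Hom X Y \<and> zero_mor C h"
    using zero_mor_unique by blast
  then show ?thesis unfolding zero_map_def by (rule theI')
qed

lemma zero_map_in_hom [simp]:
  assumes "X \<in> c_obj C" "Y \<in> c_obj C"
  shows "\<zero> X Y \<in> c_arr C" "c_dom C (\<zero> X Y) = X" "c_cod C (\<zero> X Y) = Y"
  using zero_map_zero_mor[OF assms] by auto

lemma zero_mor_iff: "h \<in> Hom X Y \<Longrightarrow> zero_mor C h \<longleftrightarrow> h = \<zero> X Y"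
  using zero_map_zero_mor[of X Y] zero_mor_unique[of h "\<zero> X Y" X Y] by auto

lemma comp_zero_map [simp]:
  assumes "g \<in> c_arr C" "c_dom C g = Y" "X \<in> c_obj C"
  shows "g \<cdot> \<zero> X Y = \<zero> X (c_cod C g)"
proof -
  have Y: "Y \<in> c_obj C" using assms by auto
  obtain Z a b where ab: "zero_obj C Z" "a \<in> Hom X Z" "b \<in> Hom Z Y" "\<zero> X Y = b \<cdot> a"
    using zero_morE zero_map_zero_mor[OF assms(3) Y] by metis
  have "zero_mor C (g \<cdot> \<zero> X Y)"
    using zero_morI[OF ab(1,2), of "g \<cdot> b" "c_cod C g"] ab assms by simp
  then show ?thesis using zero_mor_iff[of "g \<cdot> \<zero> X Y"] assms Y by simp
qed

lemma zero_map_comp [simp]: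
  assumes "f \<in> c_arr C" "c_cod C f = Y" "Z \<in> c_obj C"
  shows "\<zero> Y Z \<cdot> f = \<zero> (c_dom C f) Z"
  using abelian_category.comp_zero_map[OF dual, of f Y Z] assms by simp


subsection \<open>Monomorphisms and epimorphisms\<close>

lemma mono_iff:
  assumes "f \<in> Hom X Y"
  shows "mono C f \<longleftrightarrow> (\<forall>T. \<forall>a\<in>Hom T X. \<forall>b\<in>Hom T X. f \<cdot> a = f \<cdot> b \<longrightarrow> a = b)"
  using assms by (fastforce simp: mono_def hom_def simp del: in_hom_iff)

lemma epi_iff:
  assumes "f \<in> Hom X Y"
  shows "epi C f \<longleftrightarrow> (\<forall>T. \<forall>a\<in>Hom Y T. \<forall>b\<in>Hom Y T. a \<cdot> f = b \<cdot> f \<longrightarrow> a = b)"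
  using abelian_category.mono_iff[OF dual, of f Y X] assms by simp

lemma monoD: "mono C f \<Longrightarrow> f \<in> Hom X Y \<Longrightarrow> a \<in> Hom T X \<Longrightarrow> b \<in> Hom T X \<Longrightarrow> f \<cdot> a = f \<cdot> b \<Longrightarrow> a = b"
  using mono_iff by blast

lemma epiD: "epi C f \<Longrightarrow> f \<in> Hom X Y \<Longrightarrow> a \<in> Hom Y T \<Longrightarrow> b \<in> Hom Y T \<Longrightarrow> a \<cdot> f = b \<cdot> f \<Longrightarrow> a = b"
  using epi_iff by blast

lemma mono_comp:
  assumes "mono C f" "mono C g" "f \<in> Hom X Y" "g \<in> Hom Y Z"
  shows "mono C (g \<cdot> f)"
proof -
  have gf: "g \<cdot> f \<in> Hom X Z" using assms by simp
  show ?thesis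
    unfolding mono_iff[OF gf]
  proof (intro allI ballI impI)
    fix T a b assume ab: "a \<in> Hom T X" "b \<in> Hom T X" "(g \<cdot> f) \<cdot> a = (g \<cdot> f) \<cdot> b"
    then have "f \<cdot> a = f \<cdot> b" using monoD[OF assms(2,4), of "f \<cdot> a" T "f \<cdot> b"] assms by simp
    then show "a = b" using monoD[OF assms(1,3)] ab by blast
  qed
qed

lemma mono_if_mono_comp:
  assumes "mono C (g \<cdot> f)" "f \<in> Hom X Y" "g \<in> Hom Y Z"
  shows "mono C f"
  unfolding mono_iff[OF assms(2)]
proof (intro allI ballI impI)
  fix T a b assume ab: "a \<in> Hom T X" "b \<in> Hom T X" "f \<cdot> a = f \<cdot> b"
  then have "(g \<cdot> f) \<cdot> a = (g \<cdot> f) \<cdot> b" using assms by simp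
  then show "a = b" using monoD[OF assms(1), of X Z a T b] assms ab by simp
qed

lemma epi_comp:
  "epi C f \<Longrightarrow> epi C g \<Longrightarrow> f \<in> Hom X Y \<Longrightarrow> g \<in> Hom Y Z \<Longrightarrow> epi C (g \<cdot> f)"
  using abelian_category.mono_comp[OF dual, of g f Z Y X] by simp

lemma mono_ident: "X \<in> c_obj C \<Longrightarrow> mono C (\<one> X)"
  using mono_iff[of "\<one> X" X X] by simp

lemma mono_if_retraction:
  assumes "f \<in> Hom X Y" "r \<in> Hom Y X" "r \<cdot> f = \<one> X"
  shows "mono C f"
  using mono_if_mono_comp[OF _ assms(1,2)] mono_ident assms by simp

lemma epi_if_section: "g \<in> Hom Y Z \<Longrightarrow> s \<in> Hom Z Y \<Longrightarrow> g \<cdot> s = \<one> Z \<Longrightarrow> epi C g"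
  using abelian_category.mono_if_retraction[OF dual, of g Z Y s] by simp


subsection \<open>Kernels and cokernels\<close>

lemma kernel_iff:
  assumes "f \<in> Hom Y Z" "k \<in> Hom X Y"
  shows "is_kernel C f k \<longleftrightarrow> mono C k \<and> f \<cdot> k = \<zero> X Z \<and>
    (\<forall>T. \<forall>t\<in>Hom T Y. f \<cdot> t = \<zero> T Z \<longrightarrow> (\<exists>u\<in>Hom T X. k \<cdot> u = t))" (is "_ \<longleftrightarrow> ?mono_universal")
proof -
  have zero_iff: "zero_mor C (f \<cdot> t) \<longleftrightarrow> f \<cdot> t = \<zero> T Z" if "t \<in> Hom T Y" for T t
    using zero_mor_iff[of "f \<cdot> t" T Z] assms that by simp
  show ?thesis
  proof
    assume ker: "is_kernel C f k"
    have fk: "f \<cdot> k = \<zero> X Z" using ker zero_iff[OF assms(2)] by (simp add: is_kernel_def)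
    have factor: "\<exists>!u. u \<in> Hom T X \<and> k \<cdot> u = t" if "t \<in> Hom T Y" "f \<cdot> t = \<zero> T Z" for T t
    proof -
      have "t \<in> c_arr C" "c_cod C t = c_dom C f" "zero_mor C (f \<cdot> t)" "T = c_dom C t"
        "X = c_dom C k"
        using zero_iff[OF that(1)] that assms by simp_all
      then show ?thesis using ker unfolding is_kernel_def by blast
    qed
    have "a = b" if "a \<in> Hom T X" "b \<in> Hom T X" "k \<cdot> a = k \<cdot> b" for T a b
    proof -
      have "k \<cdot> b \<in> Hom T Y" "f \<cdot> k \<cdot> b = \<zero> T Z" using that assms comp_reduce[OF fk] by simp_all
      then show ?thesis using factor that by blast
    qed
    then show ?mono_universal unfolding mono_iff[OF assms(2)] using fk factor by blast
  next
    assume univ: ?mono_universal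
    then have "\<exists>!u. u \<in> Hom T X \<and> k \<cdot> u = t" if "t \<in> Hom T Y" "zero_mor C (f \<cdot> t)" for T t
      using that zero_iff monoD assms(2) by metis
    then show "is_kernel C f k"
      unfolding is_kernel_def using assms univ zero_iff[OF assms(2)] by auto
  qed
qed

lemma cokernel_iff:
  assumes "f \<in> Hom X Y" "c \<in> Hom Y Z"
  shows "is_cokernel C f c \<longleftrightarrow> epi C c \<and> c \<cdot> f = \<zero> X Z \<and>
    (\<forall>T. \<forall>t\<in>Hom Y T. t \<cdot> f = \<zero> X T \<longrightarrow> (\<exists>u\<in>Hom Z T. u \<cdot> c = t))"
  using abelian_category.kernel_iff[OF dual, of f Y X c Z] assms by simp

lemma kernel_in_hom: "is_kernel C f k \<Longrightarrow> f \<in> Hom Y Z \<Longrightarrow> k \<in> Hom (c_dom C k) Y"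
  by (simp add: is_kernel_def)

lemma kernel_ex:
  assumes "f \<in> Hom Y Z"
  obtains X k where "k \<in> Hom X Y" "is_kernel C f k"
proof -
  obtain k where k: "is_kernel C f k" using abelian assms by (auto simp: abelian_def)
  then show thesis using kernel_in_hom[OF k assms] that by blast
qed

lemma cokernel_ex:
  assumes "f \<in> Hom X Y"
  obtains Z c where "c \<in> Hom Y Z" "is_cokernel C f c"
  by (rule abelian_category.kernel_ex[OF dual, of f Y X]) (use assms that in auto)

lemma mono_kernel_of_cokernel:
  assumes "mono C f" "is_cokernel C f c" "f \<in> Hom X Y" "c \<in> Hom Y Z"
  shows "is_kernel C c f"
  unfolding kernel_iff[OF assms(4,3)]
proof (intro conjI allI ballI impI)
  show "c \<cdot> f = \<zero> X Z" using assms cokernel_iff by blast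
  fix T t assume t: "t \<in> Hom T Y" "c \<cdot> t = \<zero> T Z"
  obtain g where "is_kernel C g f" using abelian assms(1) by (auto simp: abelian_def)
  moreover define Z' where "Z' = c_cod C g"
  ultimately have g: "g \<in> Hom Y Z'" "is_kernel C g f" using assms(3) by (auto simp: is_kernel_def)
  then obtain u where u: "u \<in> Hom Z Z'" "u \<cdot> c = g"
    using kernel_iff[OF g(1) assms(3)] assms(2) cokernel_iff[OF assms(3,4)] by blast
  have "g \<cdot> t = \<zero> T Z'" using u t assms(4) by auto
  then show "\<exists>u\<in>Hom T X. f \<cdot> u = t" using kernel_iff[OF g(1) assms(3)] g(2) t(1) by blast
qed (fact assms(1))

lemma epi_cokernel_of_kernel:
  "epi C g \<Longrightarrow> is_kernel C g k \<Longrightarrow> k \<in> Hom X Y \<Longrightarrow> g \<in> Hom Y Z \<Longrightarrow> is_cokernel C k g"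
  using abelian_category.mono_kernel_of_cokernel[OF dual, of g k Z Y X] by simp

lemma mono_epi_inverse:
  assumes "mono C f" "epi C f" "f \<in> Hom X Y"
  obtains g where "g \<in> Hom Y X" "g \<cdot> f = \<one> X" "f \<cdot> g = \<one> Y"
proof -
  obtain Z c where c: "c \<in> Hom Y Z" "is_cokernel C f c" using cokernel_ex assms(3) by blast
  have "c \<cdot> f = \<zero> Y Z \<cdot> f"
    using c(2) cokernel_iff[OF assms(3) c(1)] assms(3) c(1) by simp
  then have "c = \<zero> Y Z" using epiD[OF assms(2,3) c(1), of "\<zero> Y Z"] c(1) assms(3) by simp
  then have "\<one> Y \<in> Hom Y Y" "c \<cdot> \<one> Y = \<zero> Y Z" using c(1) by simp_all
  then obtain g where g: "g \<in> Hom Y X" "f \<cdot> g = \<one> Y"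
    using mono_kernel_of_cokernel[OF assms(1) c(2) assms(3) c(1)] kernel_iff[OF c(1) assms(3)]
    by blast
  then have "f \<cdot> g \<cdot> f = f \<cdot> \<one> X" using assms(3) comp_reduce[OF g(2), of f] by simp
  then have "g \<cdot> f = \<one> X" using monoD[OF assms(1,3), of "g \<cdot> f" X "\<one> X"] g assms(3) by simp
  with g that show thesis by blast
qed

lemma mono_is_kernel:
  assumes "mono C f" "f \<in> Hom X Y"
  obtains Z g where "g \<in> Hom Y Z" "is_kernel C g f"
  using cokernel_ex[OF assms(2)] mono_kernel_of_cokernel[OF assms(1)] assms(2) by metis

lemma mono_cancel_zero:
  "mono C f \<Longrightarrow> f \<in> Hom X Y \<Longrightarrow> t \<in> Hom T X \<Longrightarrow> f \<cdot> t = \<zero> T Y \<Longrightarrow> t = \<zero> T X"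
  using monoD[of f X Y t T "\<zero> T X"] by simp

lemma kernel_mono_comp_iff:
  assumes "mono C m" "m \<in> Hom Z W" "f \<in> Hom Y Z" "k \<in> Hom X Y"
  shows "is_kernel C (m \<cdot> f) k \<longleftrightarrow> is_kernel C f k"
proof -
  have mf: "m \<cdot> f \<in> Hom Y W" using assms by simp
  have "(m \<cdot> f) \<cdot> t = \<zero> T W \<longleftrightarrow> f \<cdot> t = \<zero> T Z" if "t \<in> Hom T Y" for T t
    using mono_cancel_zero[OF assms(1,2), of "f \<cdot> t" T] assms(2,3) that by auto
  then show ?thesis
    unfolding kernel_iff[OF mf assms(4)] kernel_iff[OF assms(3,4)] using assms(4) by blast
qed


subsection \<open>Products and equalizers\<close>

lemma product_ex:
  assumes "A \<in> c_obj C" "B \<in> c_obj C"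
  obtains P p q where "is_product C A B P p q"
  using abelian assms unfolding abelian_def by blast

lemma coproduct_ex:
  assumes "A \<in> c_obj C" "B \<in> c_obj C"
  obtains S i j where "is_coproduct C A B S i j"
  using abelian assms unfolding abelian_def by blast

lemma product_in_hom:
  assumes "is_product C A B P p q"
  shows "p \<in> Hom P A" "q \<in> Hom P B"
  using assms by (simp_all add: is_product_def)

lemma product_pair:
  assumes "is_product C A B P p q" "f \<in> Hom T A" "g \<in> Hom T B"
  obtains u where "u \<in> Hom T P" "p \<cdot> u = f" "q \<cdot> u = g"
  using assms unfolding is_product_def by blast

lemma product_eqI:
  assumes "is_product C A B P p q" "u \<in> Hom T P" "v \<in> Hom T P" "p \<cdot> u = p \<cdot> v" "q \<cdot> u = q \<cdot> v"
  shows "u = v"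
proof -
  have "p \<cdot> v \<in> Hom T A" "q \<cdot> v \<in> Hom T B" using product_in_hom[OF assms(1)] assms(3) by simp_all
  then show ?thesis using assms unfolding is_product_def by blast
qed

lemma coproduct_in_hom:
  assumes "is_coproduct C A B S i j"
  shows "i \<in> Hom A S" "j \<in> Hom B S"
  using assms by (simp_all add: is_coproduct_def)

lemma coproduct_copair:
  assumes "is_coproduct C A B S i j" "f \<in> Hom A T" "g \<in> Hom B T"
  obtains u where "u \<in> Hom S T" "u \<cdot> i = f" "u \<cdot> j = g"
  using assms unfolding is_coproduct_def by blast

lemma coproduct_eqI:
  "is_coproduct C A B S i j \<Longrightarrow> u \<in> Hom S T \<Longrightarrow> v \<in> Hom S T \<Longrightarrow> u \<cdot> i = v \<cdot> i \<Longrightarrow> u \<cdot> j = v \<cdot> j \<Longrightarrow> u = v"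
  using abelian_category.product_eqI[OF dual, of A B S i j u T v] by simp

text \<open>The equalizer of \<open>u\<close> and \<open>v\<close> is the intersection of their graphs \<open>a\<close> and \<open>b\<close> inside the
  product; a graph, being a split monomorphism, is a kernel.\<close>

lemma equalizer_ex:
  assumes "u \<in> Hom A B" "v \<in> Hom A B"
  obtains K k where "k \<in> Hom K A" "u \<cdot> k = v \<cdot> k"
    "\<forall>T. \<forall>t\<in>Hom T A. u \<cdot> t = v \<cdot> t \<longrightarrow> (\<exists>w\<in>Hom T K. k \<cdot> w = t)" "mono C k"
proof -
  have obj: "A \<in> c_obj C" "B \<in> c_obj C" "\<one> A \<in> Hom A A" using assms by simp_all
  obtain P p q where P: "is_product C A B P p q" using product_ex obj by blast
  note pq = product_in_hom[OF P]
  obtain a where a: "a \<in> Hom A P" "p \<cdot> a = \<one> A" "q \<cdot> a = u"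
    using product_pair[OF P obj(3) assms(1)] by blast
  obtain b where b: "b \<in> Hom A P" "p \<cdot> b = \<one> A" "q \<cdot> b = v"
    using product_pair[OF P obj(3) assms(2)] by blast
  obtain D c where c: "c \<in> Hom P D" "is_kernel C c a"
    using mono_is_kernel[OF mono_if_retraction[OF a(1) pq(1) a(2)] a(1)] .
  have cb: "c \<cdot> b \<in> Hom A D" using b c by simp
  then obtain K k where k: "k \<in> Hom K A" "is_kernel C (c \<cdot> b) k" using kernel_ex by blast
  have "u \<cdot> t = v \<cdot> t \<longleftrightarrow> (c \<cdot> b) \<cdot> t = \<zero> T D" if t: "t \<in> Hom T A" for T t
  proof
    assume "u \<cdot> t = v \<cdot> t"
    then have "b \<cdot> t = a \<cdot> t"
      using product_eqI[OF P, of "b \<cdot> t" T "a \<cdot> t"] a b t pq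
        comp_reduce[OF a(2)] comp_reduce[OF b(2)] comp_reduce[OF a(3)] comp_reduce[OF b(3)] by simp
    moreover have "c \<cdot> a = \<zero> A D" using c a kernel_iff by blast
    ultimately show "(c \<cdot> b) \<cdot> t = \<zero> T D"
      using a b c t comp_reduce[of c a "\<zero> A D" t] by simp
  next
    assume "(c \<cdot> b) \<cdot> t = \<zero> T D"
    then have "b \<cdot> t \<in> Hom T P" "c \<cdot> b \<cdot> t = \<zero> T D" using b c t by simp_all
    then obtain l where l: "l \<in> Hom T A" "a \<cdot> l = b \<cdot> t"
      using c(2) kernel_iff[OF c(1) a(1)] by blast
    have "l = p \<cdot> b \<cdot> t" using comp_reduce[OF a(2), of l] a b l pq by simp
    then have "l = t" using comp_reduce[OF b(2), of t] b t pq by simp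
    then show "u \<cdot> t = v \<cdot> t"
      using comp_reduce[OF a(3), of t] comp_reduce[OF b(3), of t] a b l t pq by simp
  qed
  then show thesis using that[OF k(1)] k kernel_iff[OF cb k(1)] by metis
qed

text \<open>If \<open>f\<close> equalizes \<open>a\<close> and \<open>b\<close> then it factors through their equalizer, whose cokernel therefore
  annihilates \<open>f\<close>.\<close>

lemma epi_if_cokernel_zero:
  assumes f: "f \<in> Hom X Y" and coker: "\<And>T t. t \<in> Hom Y T \<Longrightarrow> t \<cdot> f = \<zero> X T \<Longrightarrow> t = \<zero> Y T"
  shows "epi C f"
proof -
  have "a = b" if ab: "a \<in> Hom Y T" "b \<in> Hom Y T" "a \<cdot> f = b \<cdot> f" for T a b
  proof -
    obtain K k where k: "k \<in> Hom K Y" "a \<cdot> k = b \<cdot> k" "mono C k" and "\<exists>w\<in>Hom X K. k \<cdot> w = f"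
      using equalizer_ex[OF ab(1,2)] ab(3) f by metis
    then obtain w where w: "w \<in> Hom X K" "k \<cdot> w = f" by blast
    obtain D c where c: "c \<in> Hom Y D" "is_kernel C c k" using mono_is_kernel k by blast
    have "c \<cdot> k = \<zero> K D" using c k kernel_iff by blast
    then have "c \<cdot> f = \<zero> X D" using comp_reduce[of c k _ w] c k w by simp
    then have "\<one> Y \<in> Hom Y Y" "c \<cdot> \<one> Y = \<zero> Y D" using coker[OF c(1)] c by simp_all
    then obtain s where s: "s \<in> Hom Y K" "k \<cdot> s = \<one> Y"
      using c(2) kernel_iff[OF c(1) k(1)] by blast
    have "a = a \<cdot> k \<cdot> s" "b = b \<cdot> k \<cdot> s" using ab s by simp_all
    then show ?thesis using comp_reduce[OF k(2), of s] ab k s by simp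
  qed
  then show ?thesis using epi_iff[OF f] by blast
qed

lemma mono_if_kernel_zero:
  assumes "f \<in> Hom X Y" "\<And>T t. t \<in> Hom T X \<Longrightarrow> f \<cdot> t = \<zero> T Y \<Longrightarrow> t = \<zero> T X"
  shows "mono C f"
  using abelian_category.epi_if_cokernel_zero[OF dual, of f Y X] assms by simp


section \<open>Short exact sequences\<close>

lemma kernel_if_exact_at_mono:
  assumes fg: "f \<in> Hom X Y" "g \<in> Hom Y Z" and "mono C f" and exact: "exact_at C f g"
  shows "is_kernel C g f"
  unfolding kernel_iff[OF fg(2,1)]
proof (intro conjI allI ballI impI)
  show "g \<cdot> f = \<zero> X Z"
    using exact zero_mor_iff[of "g \<cdot> f" X Z] fg by (simp add: exact_at_def)
  obtain k u where k: "is_kernel C g k"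
    and u: "u \<in> Hom (c_dom C f) (c_dom C k)" "k \<cdot> u = f" "epi C u"
    using exact unfolding exact_at_def by blast
  define K where "K = c_dom C k"
  have kh: "k \<in> Hom K Y" and uh: "u \<in> Hom X K"
    using kernel_in_hom[OF k fg(2)] u(1) fg(1) by (simp_all add: K_def)
  have "mono C u" using mono_if_mono_comp[OF _ uh kh] u(2) \<open>mono C f\<close> by simp
  then obtain v where v: "v \<in> Hom K X" "u \<cdot> v = \<one> K" using mono_epi_inverse u(3) uh by blast
  fix T t assume "t \<in> Hom T Y" "g \<cdot> t = \<zero> T Z"
  then obtain w where w: "w \<in> Hom T K" "k \<cdot> w = t" using k kernel_iff[OF fg(2) kh] by blast
  have "f \<cdot> v \<cdot> w = t"
    using comp_reduce[OF u(2), of "v \<cdot> w"] comp_reduce[OF v(2), of w] w kh uh v by simp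
  moreover have "v \<cdot> w \<in> Hom T X" using v w by simp
  ultimately show "\<exists>u\<in>Hom T X. f \<cdot> u = t" by blast
qed (fact \<open>mono C f\<close>)

lemma short_exact_iff:
  "short_exact C X Y Z f g \<longleftrightarrow>
     f \<in> Hom X Y \<and> g \<in> Hom Y Z \<and> is_kernel C g f \<and> is_cokernel C f g"
proof
  assume "short_exact C X Y Z f g"
  then show "f \<in> Hom X Y \<and> g \<in> Hom Y Z \<and> is_kernel C g f \<and> is_cokernel C f g"
    using kernel_if_exact_at_mono epi_cokernel_of_kernel unfolding short_exact_def by blast
next
  assume "f \<in> Hom X Y \<and> g \<in> Hom Y Z \<and> is_kernel C g f \<and> is_cokernel C f g"
  then have fg: "f \<in> Hom X Y" "g \<in> Hom Y Z" and ker: "is_kernel C g f"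
    and coker: "is_cokernel C f g"
    by blast+
  have "mono C f" "epi C g"
    using ker coker kernel_iff[OF fg(2,1)] cokernel_iff[OF fg] by blast+
  moreover have "f \<in> c_arr C" "g \<in> c_arr C" "c_cod C f = c_dom C g"
    "\<one> X \<in> Hom (c_dom C f) (c_dom C f)" "f \<cdot> \<one> X = f" "epi C (\<one> X)"
    using fg epi_if_section[of "\<one> X" X X "\<one> X"] by simp_all
  moreover have "zero_mor C (g \<cdot> f)" using ker unfolding is_kernel_def by blast
  ultimately show "short_exact C X Y Z f g"
    unfolding short_exact_def exact_at_def using fg ker by blast
qed

lemma
  assumes "short_exact C X Y Z f g"
  shows short_exact_in_hom: "f \<in> Hom X Y" "g \<in> Hom Y Z"
    and short_exact_comp: "g \<cdot> f = \<zero> X Z"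
    and short_exact_mono: "mono C f"
    and short_exact_epi: "epi C g"
    and short_exact_kernel: "is_kernel C g f"
  using assms kernel_iff cokernel_iff unfolding short_exact_iff by blast+

lemma short_exact_obj:
  assumes "short_exact C X Y Z f g"
  shows "X \<in> c_obj C" "Y \<in> c_obj C" "Z \<in> c_obj C"
  using short_exact_in_hom[OF assms] by simp_all

lemma short_exact_op_cat [simp]: "short_exact (op_cat C) Z Y X g f \<longleftrightarrow> short_exact C X Y Z f g"
  unfolding short_exact_iff abelian_category.short_exact_iff[OF dual] by auto

lemma short_exact_lift:
  assumes "short_exact C X Y Z f g" "t \<in> Hom T Y" "g \<cdot> t = \<zero> T Z"
  obtains u where "u \<in> Hom T X" "f \<cdot> u = t"
  using assms kernel_iff unfolding short_exact_iff by blast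

lemma short_exact_factor:
  assumes "short_exact C X Y Z f g" "t \<in> Hom Y T" "t \<cdot> f = \<zero> X T"
  obtains u where "u \<in> Hom Z T" "u \<cdot> g = t"
  using assms cokernel_iff unfolding short_exact_iff by blast

lemma short_exact_if_kernel:
  assumes "is_kernel C g f" "epi C g" "f \<in> Hom X Y" "g \<in> Hom Y Z"
  shows "short_exact C X Y Z f g"
  using assms epi_cokernel_of_kernel unfolding short_exact_iff by blast

lemma short_exact_if_cokernel:
  "is_cokernel C f g \<Longrightarrow> mono C f \<Longrightarrow> f \<in> Hom X Y \<Longrightarrow> g \<in> Hom Y Z \<Longrightarrow> short_exact C X Y Z f g"
  using mono_kernel_of_cokernel unfolding short_exact_iff by blast

lemma short_five_mono:
  assumes se: "short_exact C X Y Z f g" and h: "h \<in> Hom Y Y'" and f': "f' \<in> Hom X Y'" "mono C f'"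
    and g': "g' \<in> Hom Y' Z" and comm: "h \<cdot> f = f'" "g' \<cdot> h = g"
  shows "mono C h"
proof (rule mono_if_kernel_zero[OF h])
  note fg = short_exact_in_hom[OF se]
  fix T t assume t: "t \<in> Hom T Y" "h \<cdot> t = \<zero> T Y'"
  have "g \<cdot> t = \<zero> T Z" using comp_reduce[OF comm(2), of t] t h g' by simp
  then obtain u where u: "u \<in> Hom T X" "f \<cdot> u = t" using short_exact_lift[OF se t(1)] by blast
  have "f' \<cdot> u = \<zero> T Y'" using comp_reduce[OF comm(1), of u] u t fg h by simp
  then have "u = \<zero> T X" using mono_cancel_zero[OF f'(2,1) u(1)] by blast
  then show "t = \<zero> T Y" using u fg by simp
qed

lemma short_five_epi:
  "short_exact C X Y Z f g \<Longrightarrow> h \<in> Hom Y' Y \<Longrightarrow> g' \<in> Hom Y' Z \<Longrightarrow> epi C g' \<Longrightarrow> f' \<in> Hom X Y' \<Longrightarrow>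
    g \<cdot> h = g' \<Longrightarrow> h \<cdot> f' = f \<Longrightarrow> epi C h"
  using abelian_category.short_five_mono[OF dual, of Z Y X g f h Y' g' f'] by simp

lemma short_five:
  assumes "short_exact C X Y Z f g" "short_exact C X Y' Z f' g'" "h \<in> Hom Y Y'"
    "h \<cdot> f = f'" "g' \<cdot> h = g"
  obtains h' where "h' \<in> Hom Y' Y" "h' \<cdot> h = \<one> Y" "h \<cdot> h' = \<one> Y'"
proof -
  have "mono C h"
    using short_five_mono[OF assms(1,3)] short_exact_in_hom[OF assms(2)]
      short_exact_mono[OF assms(2)] assms(4,5) by blast
  moreover have "epi C h"
    using short_five_epi[OF assms(2,3)] short_exact_in_hom[OF assms(1)] short_exact_epi[OF assms(1)]
      assms(4,5) by blast
  ultimately show thesis using mono_epi_inverse[OF _ _ assms(3)] that by blast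
qed


subsection \<open>Biproducts and split sequences\<close>

lemma is_coproduct_swap: "is_coproduct C A B S i j \<Longrightarrow> is_coproduct C B A S j i"
  unfolding is_coproduct_def by metis

lemma is_product_swap: "is_product C A B P p q \<Longrightarrow> is_product C B A P q p"
  unfolding is_product_def by metis

lemma is_coproduct_iso:
  assumes S: "is_coproduct C A B S i j"
    and h: "h \<in> Hom S S'" "h' \<in> Hom S' S" "h' \<cdot> h = \<one> S" "h \<cdot> h' = \<one> S'"
  shows "is_coproduct C A B S' (h \<cdot> i) (h \<cdot> j)"
  unfolding is_coproduct_def
proof (intro conjI allI impI)
  note ij = coproduct_in_hom[OF S]
  show "S' \<in> c_obj C" "h \<cdot> i \<in> Hom A S'" "h \<cdot> j \<in> Hom B S'" using h ij by simp_all
  fix T a b assume "a \<in> Hom A T \<and> b \<in> Hom B T"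
  then obtain u where u: "u \<in> Hom S T" "u \<cdot> i = a" "u \<cdot> j = b" using coproduct_copair[OF S] by blast
  show "\<exists>!v. v \<in> Hom S' T \<and> v \<cdot> h \<cdot> i = a \<and> v \<cdot> h \<cdot> j = b"
  proof (rule ex1I)
    show "u \<cdot> h' \<in> Hom S' T \<and> (u \<cdot> h') \<cdot> h \<cdot> i = a \<and> (u \<cdot> h') \<cdot> h \<cdot> j = b"
      using u h ij comp_reduce[OF h(3), of i] comp_reduce[OF h(3), of j] by simp
    fix v assume v: "v \<in> Hom S' T \<and> v \<cdot> h \<cdot> i = a \<and> v \<cdot> h \<cdot> j = b"
    then have "v \<cdot> h = u" using coproduct_eqI[OF S, of "v \<cdot> h" T u] u h ij by simp
    then show "v = u \<cdot> h'" using comp_reduce[of v h u h'] v h by simp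
  qed
qed

lemma coproduct_projections:
  assumes "is_coproduct C A B S i j"
  obtains p q where "p \<in> Hom S A" "p \<cdot> i = \<one> A" "p \<cdot> j = \<zero> B A"
    "q \<in> Hom S B" "q \<cdot> i = \<zero> A B" "q \<cdot> j = \<one> B"
proof -
  have homs: "\<one> A \<in> Hom A A" "\<zero> B A \<in> Hom B A" "\<zero> A B \<in> Hom A B" "\<one> B \<in> Hom B B"
    using coproduct_in_hom[OF assms] by simp_all
  show thesis
    using coproduct_copair[OF assms homs(1,2)] coproduct_copair[OF assms homs(3,4)] that by metis
qed

lemma coproduct_short_exact:
  assumes S: "is_coproduct C A B S i j" and q: "q \<in> Hom S B" "q \<cdot> i = \<zero> A B" "q \<cdot> j = \<one> B"
  shows "short_exact C A S B i q"
proof (rule short_exact_if_cokernel)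
  note ij = coproduct_in_hom[OF S]
  show "is_cokernel C i q"
    unfolding cokernel_iff[OF ij(1) q(1)]
  proof (intro conjI allI ballI impI)
    show "epi C q" using epi_if_section[OF q(1) ij(2) q(3)] .
    fix T t assume t: "t \<in> Hom S T" "t \<cdot> i = \<zero> A T"
    have "(t \<cdot> j) \<cdot> q = t"
      using coproduct_eqI[OF S, of "(t \<cdot> j) \<cdot> q" T t] t ij q by simp
    moreover have "t \<cdot> j \<in> Hom B T" using t ij by simp
    ultimately show "\<exists>u\<in>Hom B T. u \<cdot> q = t" by blast
  qed (fact q)
  obtain p where "p \<in> Hom S A" "p \<cdot> i = \<one> A" using coproduct_projections[OF S] by metis
  then show "mono C i" using mono_if_retraction ij(1) by blast
qed (use coproduct_in_hom[OF S] q in blast)+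

lemma product_short_exact:
  "is_product C A B P p q \<Longrightarrow> j \<in> Hom B P \<Longrightarrow> p \<cdot> j = \<zero> B A \<Longrightarrow> q \<cdot> j = \<one> B \<Longrightarrow> short_exact C B P A j p"
  using abelian_category.coproduct_short_exact[OF dual, of A B P p q j] by simp

end

definition biproduct :: "('o,'m) category \<Rightarrow> 'o \<Rightarrow> 'o \<Rightarrow> 'o \<Rightarrow> 'm \<Rightarrow> 'm \<Rightarrow> 'm \<Rightarrow> 'm \<Rightarrow> bool" where
  "biproduct C A B S i j p q \<longleftrightarrow> is_coproduct C A B S i j \<and> is_product C A B S p q \<and>
     c_comp C p i = c_id C A \<and> c_comp C q j = c_id C B \<and>
     c_comp C p j = zero_map C B A \<and> c_comp C q i = zero_map C A B"

definition direct_sum :: "('o,'m) category \<Rightarrow> 'o \<Rightarrow> 'o \<Rightarrow> 'o \<Rightarrow> bool" where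
  "direct_sum C A B S \<longleftrightarrow> (\<exists>i j p q. biproduct C A B S i j p q)"

lemma biproduct_op_cat [simp]: "biproduct (op_cat C) A B S p q i j \<longleftrightarrow> biproduct C A B S i j p q"
  by (auto simp: biproduct_def)

lemma direct_sum_op_cat [simp]: "direct_sum (op_cat C) A B S \<longleftrightarrow> direct_sum C A B S"
  unfolding direct_sum_def biproduct_op_cat by blast

context abelian_category
begin

lemma
  assumes "biproduct C A B S i j p q"
  shows biproduct_coproduct: "is_coproduct C A B S i j"
    and biproduct_product: "is_product C A B S p q"
    and biproduct_in_hom: "i \<in> Hom A S" "j \<in> Hom B S" "p \<in> Hom S A" "q \<in> Hom S B"
    and biproduct_comp: "p \<cdot> i = \<one> A" "q \<cdot> j = \<one> B" "p \<cdot> j = \<zero> B A" "q \<cdot> i = \<zero> A B"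
  using assms coproduct_in_hom product_in_hom unfolding biproduct_def by blast+

text \<open>The canonical morphism from the coproduct to the product is invertible: it is a morphism of
  short exact sequences with identities at both ends.\<close>

lemma biproduct_if_coproduct:
  assumes S: "is_coproduct C A B S i j"
  obtains p q where "biproduct C A B S i j p q"
proof -
  note ij = coproduct_in_hom[OF S]
  obtain p q where pq: "p \<in> Hom S A" "p \<cdot> i = \<one> A" "p \<cdot> j = \<zero> B A"
    "q \<in> Hom S B" "q \<cdot> i = \<zero> A B" "q \<cdot> j = \<one> B"
    using coproduct_projections[OF S] .
  have obj: "A \<in> c_obj C" "B \<in> c_obj C" using ij by simp_all
  obtain P p' q' where P: "is_product C A B P p' q'" using product_ex obj by blast
  note pq' = product_in_hom[OF P]
  obtain h where h: "h \<in> Hom S P" "p' \<cdot> h = p" "q' \<cdot> h = q"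
    using product_pair[OF P pq(1,4)] .
  have "short_exact C B P A (h \<cdot> j) p'"
    using product_short_exact[OF P, of "h \<cdot> j"] comp_reduce[OF h(2), of j]
      comp_reduce[OF h(3), of j] h ij pq pq' by simp
  moreover have "short_exact C B S A j p"
    using coproduct_short_exact[OF is_coproduct_swap[OF S]] pq by blast
  ultimately obtain h' where h': "h' \<in> Hom P S" "h' \<cdot> h = \<one> S" "h \<cdot> h' = \<one> P"
    using short_five h by metis
  have "is_coproduct (op_cat C) A B S (c_comp (op_cat C) h p') (c_comp (op_cat C) h q')"
    using abelian_category.is_coproduct_iso[OF dual, of A B P p' q' h S h'] P h h' by simp
  then show thesis using that S pq h by (simp add: biproduct_def)
qed

lemma direct_sum_if_coproduct: "is_coproduct C A B S i j \<Longrightarrow> direct_sum C A B S"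
  unfolding direct_sum_def using biproduct_if_coproduct by metis

lemma biproduct_swap: "biproduct C A B S i j p q \<Longrightarrow> biproduct C B A S j i q p"
  unfolding biproduct_def using is_coproduct_swap is_product_swap by blast

lemma direct_sum_commute: "direct_sum C A B S \<Longrightarrow> direct_sum C B A S"
  unfolding direct_sum_def using biproduct_swap by blast

lemma biproduct_ex:
  assumes "A \<in> c_obj C" "B \<in> c_obj C"
  obtains S i j p q where "biproduct C A B S i j p q"
  using coproduct_ex[OF assms] biproduct_if_coproduct by metis

lemma biproduct_short_exact: "biproduct C A B S i j p q \<Longrightarrow> short_exact C A S B i q"
  using coproduct_short_exact biproduct_coproduct biproduct_in_hom biproduct_comp by metis

lemma biproduct_if_section:
  assumes se: "short_exact C X Y Z f g" and s: "s \<in> Hom Z Y" "g \<cdot> s = \<one> Z"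
  obtains r where "biproduct C X Z Y f s r g"
proof -
  note fg = short_exact_in_hom[OF se]
  obtain S i j p q where S: "biproduct C X Z S i j p q"
    using biproduct_ex short_exact_obj[OF se] by metis
  note cop = biproduct_coproduct[OF S] and homs = biproduct_in_hom[OF S]
  obtain h where h: "h \<in> Hom S Y" "h \<cdot> i = f" "h \<cdot> j = s"
    using coproduct_copair[OF cop fg(1) s(1)] .
  have "g \<cdot> h = q"
    using coproduct_eqI[OF cop, of "g \<cdot> h" Z q] h homs fg s short_exact_comp[OF se]
      biproduct_comp[OF S] by simp
  then obtain h' where h': "h' \<in> Hom Y S" "h' \<cdot> h = \<one> S" "h \<cdot> h' = \<one> Y"
    using short_five[OF biproduct_short_exact[OF S] se h(1,2)] by blast
  then have cop': "is_coproduct C X Z Y f s"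
    using is_coproduct_iso[OF cop h(1) h'] h by simp
  then obtain r q' where r: "biproduct C X Z Y f s r q'" by (rule biproduct_if_coproduct)
  have "g = q'"
    using coproduct_eqI[OF cop', of g Z q'] biproduct_in_hom[OF r] biproduct_comp[OF r] fg s
      short_exact_comp[OF se] by simp
  then show thesis using r that by blast
qed

lemma biproduct_if_retraction:
  assumes "short_exact C X Y Z f g" "r \<in> Hom Y X" "r \<cdot> f = \<one> X"
  obtains s where "biproduct C X Z Y f s r g"
  using abelian_category.biproduct_if_section[OF dual, of Z Y X g f r] assms that
    biproduct_swap[of Z X Y _ f g r] by auto

end


subsection \<open>Pullbacks\<close>

definition is_pullback ::
  "('o,'m) category \<Rightarrow> 'o \<Rightarrow> 'o \<Rightarrow> 'o \<Rightarrow> 'm \<Rightarrow> 'm \<Rightarrow> 'o \<Rightarrow> 'm \<Rightarrow> 'm \<Rightarrow> bool" where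
  "is_pullback C A B Z f g E p q \<longleftrightarrow>
     f \<in> hom C A Z \<and> g \<in> hom C B Z \<and> p \<in> hom C E A \<and> q \<in> hom C E B \<and> c_comp C f p = c_comp C g q \<and>
     (\<forall>T x y. x \<in> hom C T A \<and> y \<in> hom C T B \<and> c_comp C f x = c_comp C g y \<longrightarrow>
        (\<exists>!u. u \<in> hom C T E \<and> c_comp C p u = x \<and> c_comp C q u = y))"

context abelian_category
begin

lemma
  assumes "is_pullback C A B Z f g E p q"
  shows pullback_in_hom: "f \<in> Hom A Z" "g \<in> Hom B Z" "p \<in> Hom E A" "q \<in> Hom E B"
    and pullback_comp: "f \<cdot> p = g \<cdot> q"
  using assms unfolding is_pullback_def by blast+

lemma pullback_lift:
  assumes "is_pullback C A B Z f g E p q" "x \<in> Hom T A" "y \<in> Hom T B" "f \<cdot> x = g \<cdot> y"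
  obtains u where "u \<in> Hom T E" "p \<cdot> u = x" "q \<cdot> u = y"
  using assms unfolding is_pullback_def by blast

lemma pullback_eqI:
  assumes pb: "is_pullback C A B Z f g E p q" and uv: "u \<in> Hom T E" "v \<in> Hom T E"
    and eq: "p \<cdot> u = p \<cdot> v" "q \<cdot> u = q \<cdot> v"
  shows "u = v"
proof -
  have "p \<cdot> v \<in> Hom T A" "q \<cdot> v \<in> Hom T B" "f \<cdot> p \<cdot> v = g \<cdot> q \<cdot> v"
    using pullback_in_hom[OF pb] comp_reduce[OF pullback_comp[OF pb], of v] uv by simp_all
  then show ?thesis using pb uv eq unfolding is_pullback_def by blast
qed

lemma is_pullbackI:
  assumes "f \<in> Hom A Z" "g \<in> Hom B Z" "p \<in> Hom E A" "q \<in> Hom E B" "f \<cdot> p = g \<cdot> q"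
    and "\<And>T x y. x \<in> Hom T A \<Longrightarrow> y \<in> Hom T B \<Longrightarrow> f \<cdot> x = g \<cdot> y \<Longrightarrow> \<exists>u\<in>Hom T E. p \<cdot> u = x \<and> q \<cdot> u = y"
    and "\<And>T u v. u \<in> Hom T E \<Longrightarrow> v \<in> Hom T E \<Longrightarrow> p \<cdot> u = p \<cdot> v \<Longrightarrow> q \<cdot> u = q \<cdot> v \<Longrightarrow> u = v"
  shows "is_pullback C A B Z f g E p q"
  unfolding is_pullback_def
proof (intro conjI allI impI)
  fix T x y assume "x \<in> Hom T A \<and> y \<in> Hom T B \<and> f \<cdot> x = g \<cdot> y"
  then obtain u where u: "u \<in> Hom T E" "p \<cdot> u = x" "q \<cdot> u = y" using assms(6) by blast
  show "\<exists>!u. u \<in> Hom T E \<and> p \<cdot> u = x \<and> q \<cdot> u = y"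
  proof (rule ex1I[of _ u])
    show "v = u" if "v \<in> Hom T E \<and> p \<cdot> v = x \<and> q \<cdot> v = y" for v
      using assms(7)[of v T u] u that by metis
  qed (use u in blast)
qed (fact assms)+

lemma is_pullback_swap: "is_pullback C A B Z f g E p q \<Longrightarrow> is_pullback C B A Z g f E q p"
  unfolding is_pullback_def by metis

lemma is_pullback_iso:
  assumes pb: "is_pullback C A B Z f g E p q"
    and h: "h \<in> Hom E' E" "h' \<in> Hom E E'" "h' \<cdot> h = \<one> E'" "h \<cdot> h' = \<one> E"
  shows "is_pullback C A B Z f g E' (p \<cdot> h) (q \<cdot> h)"
proof (rule is_pullbackI[OF pullback_in_hom(1,2)[OF pb]])
  note homs = pullback_in_hom[OF pb]
  show "p \<cdot> h \<in> Hom E' A" "q \<cdot> h \<in> Hom E' B" "f \<cdot> p \<cdot> h = g \<cdot> q \<cdot> h"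
    using homs h(1) comp_reduce[OF pullback_comp[OF pb], of h] by simp_all
  fix T x y assume xy: "x \<in> Hom T A" "y \<in> Hom T B" "f \<cdot> x = g \<cdot> y"
  obtain u where u: "u \<in> Hom T E" "p \<cdot> u = x" "q \<cdot> u = y" using pullback_lift[OF pb xy] .
  then have "h' \<cdot> u \<in> Hom T E'" "(p \<cdot> h) \<cdot> h' \<cdot> u = x" "(q \<cdot> h) \<cdot> h' \<cdot> u = y"
    using comp_reduce[OF h(4), of u] h homs by simp_all
  then show "\<exists>u\<in>Hom T E'. (p \<cdot> h) \<cdot> u = x \<and> (q \<cdot> h) \<cdot> u = y" by blast
next
  fix T u v
  assume uv: "u \<in> Hom T E'" "v \<in> Hom T E'" "(p \<cdot> h) \<cdot> u = (p \<cdot> h) \<cdot> v" "(q \<cdot> h) \<cdot> u = (q \<cdot> h) \<cdot> v"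
  then have "h \<cdot> u = h \<cdot> v"
    using pullback_eqI[OF pb, of "h \<cdot> u" T "h \<cdot> v"] pullback_in_hom[OF pb] h(1) by simp
  then show "u = v" using monoD[OF mono_if_retraction[OF h(1-3)] h(1)] uv(1,2) by blast
qed

lemma pullback_ex:
  assumes f: "f \<in> Hom A Z" and g: "g \<in> Hom B Z"
  obtains E p q where "is_pullback C A B Z f g E p q"
proof -
  have "A \<in> c_obj C" "B \<in> c_obj C" using f g by simp_all
  then obtain P \<pi> \<rho> where P: "is_product C A B P \<pi> \<rho>" using product_ex by blast
  note \<pi>\<rho> = product_in_hom[OF P]
  have "f \<cdot> \<pi> \<in> Hom P Z" "g \<cdot> \<rho> \<in> Hom P Z" using f g \<pi>\<rho> by simp_all
  then obtain E k where k: "k \<in> Hom E P" "(f \<cdot> \<pi>) \<cdot> k = (g \<cdot> \<rho>) \<cdot> k" and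
    factor: "\<forall>T. \<forall>t\<in>Hom T P. (f \<cdot> \<pi>) \<cdot> t = (g \<cdot> \<rho>) \<cdot> t \<longrightarrow> (\<exists>w\<in>Hom T E. k \<cdot> w = t)" and
    "mono C k"
    by (rule equalizer_ex)
  have "is_pullback C A B Z f g E (\<pi> \<cdot> k) (\<rho> \<cdot> k)"
  proof (rule is_pullbackI[OF f g])
    show "\<pi> \<cdot> k \<in> Hom E A" "\<rho> \<cdot> k \<in> Hom E B" "f \<cdot> \<pi> \<cdot> k = g \<cdot> \<rho> \<cdot> k" using k f g \<pi>\<rho> by simp_all
  next
    fix T x y assume xy: "x \<in> Hom T A" "y \<in> Hom T B" "f \<cdot> x = g \<cdot> y"
    obtain t where t: "t \<in> Hom T P" "\<pi> \<cdot> t = x" "\<rho> \<cdot> t = y" using product_pair[OF P xy(1,2)] .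
    then have "(f \<cdot> \<pi>) \<cdot> t = (g \<cdot> \<rho>) \<cdot> t" using f g \<pi>\<rho> xy by simp
    then obtain w where "w \<in> Hom T E" "k \<cdot> w = t" using factor t by blast
    then show "\<exists>u\<in>Hom T E. (\<pi> \<cdot> k) \<cdot> u = x \<and> (\<rho> \<cdot> k) \<cdot> u = y"
      using k t \<pi>\<rho> by (intro bexI[of _ w]) simp_all
  next
    fix T u v
    assume uv: "u \<in> Hom T E" "v \<in> Hom T E" "(\<pi> \<cdot> k) \<cdot> u = (\<pi> \<cdot> k) \<cdot> v" "(\<rho> \<cdot> k) \<cdot> u = (\<rho> \<cdot> k) \<cdot> v"
    then have "k \<cdot> u = k \<cdot> v" using product_eqI[OF P, of "k \<cdot> u" T "k \<cdot> v"] k \<pi>\<rho> by simp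
    then show "u = v" using monoD[OF \<open>mono C k\<close> k(1) uv(1,2)] by blast
  qed
  then show thesis by (rule that)
qed

lemma pullback_mono:
  assumes pb: "is_pullback C A B Z f g E p q" and "mono C g"
  shows "mono C p"
proof -
  note homs = pullback_in_hom[OF pb] and comm = pullback_comp[OF pb]
  have "u = v" if uv: "u \<in> Hom T E" "v \<in> Hom T E" "p \<cdot> u = p \<cdot> v" for T u v
  proof -
    have "g \<cdot> q \<cdot> u = g \<cdot> q \<cdot> v"
      using comp_reduce[OF comm, of u] comp_reduce[OF comm, of v] uv homs by simp
    then have "q \<cdot> u = q \<cdot> v"
      using monoD[OF \<open>mono C g\<close> homs(2), of "q \<cdot> u" T "q \<cdot> v"] uv homs by simp
    then show ?thesis using pullback_eqI[OF pb uv(1,2)] uv(3) by blast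
  qed
  then show ?thesis using mono_iff[OF homs(3)] by blast
qed

lemma pullback_kernel:
  assumes pb: "is_pullback C A B Z f g E p q" and ker: "is_kernel C c g" and c: "c \<in> Hom Z D"
  shows "is_kernel C (c \<cdot> f) p"
proof -
  note homs = pullback_in_hom[OF pb] and comm = pullback_comp[OF pb]
  have cf: "c \<cdot> f \<in> Hom A D" using homs c by simp
  have g: "mono C g" "c \<cdot> g = \<zero> B D" using ker kernel_iff[OF c homs(2)] by blast+
  show ?thesis
    unfolding kernel_iff[OF cf homs(3)]
  proof (intro conjI allI ballI impI)
    show "mono C p" using pullback_mono[OF pb g(1)] .
    show "(c \<cdot> f) \<cdot> p = \<zero> E D" using comm comp_reduce[OF g(2), of q] homs c by simp
    fix T t assume t: "t \<in> Hom T A" "(c \<cdot> f) \<cdot> t = \<zero> T D"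
    then have "f \<cdot> t \<in> Hom T Z" "c \<cdot> f \<cdot> t = \<zero> T D" using homs c by simp_all
    then obtain y where "y \<in> Hom T B" "g \<cdot> y = f \<cdot> t" using ker kernel_iff[OF c homs(2)] by blast
    then show "\<exists>u\<in>Hom T E. p \<cdot> u = t" using pullback_lift[OF pb t(1)] by metis
  qed
qed

lemma cokernel_restrict_if_pullback_factors:
  assumes pb: "is_pullback C A B Z f g E p q" and "epi C f" "mono C g"
    and c: "is_cokernel C g c" "c \<in> Hom Z D" and me: "m \<in> Hom I B" "e \<in> Hom E I" "m \<cdot> e = q"
  shows "is_cokernel C (g \<cdot> m) c"
proof -
  note homs = pullback_in_hom[OF pb] and comm = pullback_comp[OF pb]
  have cg: "c \<cdot> g = \<zero> B D" and "epi C c" using c cokernel_iff[OF homs(2) c(2)] by blast+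
  have cf: "c \<cdot> f \<in> Hom A D" "epi C (c \<cdot> f)"
    using homs c epi_comp[OF \<open>epi C f\<close> \<open>epi C c\<close> homs(1) c(2)] by simp_all
  have "is_kernel C (c \<cdot> f) p"
    using pullback_kernel[OF pb _ c(2)] mono_kernel_of_cokernel[OF \<open>mono C g\<close> c(1) homs(2) c(2)]
    by blast
  then have coker: "is_cokernel C p (c \<cdot> f)" using epi_cokernel_of_kernel cf homs by blast
  have gm: "g \<cdot> m \<in> Hom I Z" using homs me by simp
  show ?thesis
    unfolding cokernel_iff[OF gm c(2)]
  proof (intro conjI allI ballI impI)
    show "c \<cdot> g \<cdot> m = \<zero> I D" using comp_reduce[OF cg, of m] homs c(2) me by simp
    fix S s assume s: "s \<in> Hom Z S" "s \<cdot> g \<cdot> m = \<zero> I S"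
    have "s \<cdot> f \<cdot> p = (s \<cdot> g \<cdot> m) \<cdot> e" using comm me s(1) homs by simp
    then have "s \<cdot> f \<in> Hom A S" "(s \<cdot> f) \<cdot> p = \<zero> E S" using s me homs by simp_all
    then obtain u where u: "u \<in> Hom D S" "u \<cdot> c \<cdot> f = s \<cdot> f"
      using coker cokernel_iff[OF homs(3) cf(1)] by blast
    then have "u \<cdot> c = s"
      using epiD[OF \<open>epi C f\<close> homs(1), of "u \<cdot> c" S s] c(2) s homs by simp
    with u(1) show "\<exists>u\<in>Hom D S. u \<cdot> c = s" by blast
  qed (fact \<open>epi C c\<close>)
qed

text \<open>If \<open>t \<cdot> q = 0\<close>, then \<open>g\<close> and its restriction to the kernel of \<open>t\<close> have the same cokernel,
  hence they are the same subobject.\<close>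

lemma pullback_along_mono_epi:
  assumes pb: "is_pullback C A B Z f g E p q" and "epi C f" "mono C g"
  shows "epi C q"
proof (rule epi_if_cokernel_zero)
  note homs = pullback_in_hom[OF pb]
  show "q \<in> Hom E B" by (fact homs)
  fix T t assume t: "t \<in> Hom B T" "t \<cdot> q = \<zero> E T"
  obtain I m where m: "m \<in> Hom I B" "is_kernel C t m" using kernel_ex t by blast
  then have tm: "t \<cdot> m = \<zero> I T" and "mono C m" using kernel_iff t by blast+
  obtain e where e: "e \<in> Hom E I" "m \<cdot> e = q" using kernel_iff[OF t(1) m(1)] m(2) t(2) homs by blast
  obtain D c where c: "c \<in> Hom Z D" "is_cokernel C g c" using cokernel_ex homs by blast
  have gm: "g \<cdot> m \<in> Hom I Z" using homs m by simp
  have "is_cokernel C (g \<cdot> m) c"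
    using cokernel_restrict_if_pullback_factors[OF assms c(2,1) m(1) e] .
  then have "is_kernel C c (g \<cdot> m)"
    using mono_kernel_of_cokernel[OF mono_comp[OF \<open>mono C m\<close> \<open>mono C g\<close> m(1) homs(2)]] gm c by blast
  moreover have "c \<cdot> g = \<zero> B D" using c cokernel_iff[OF homs(2) c(1)] by blast
  ultimately obtain v where v: "v \<in> Hom B I" "(g \<cdot> m) \<cdot> v = g"
    using kernel_iff[OF c(1) gm] homs by blast
  then have "m \<cdot> v = \<one> B"
    using monoD[OF \<open>mono C g\<close> homs(2), of "m \<cdot> v" B "\<one> B"] homs m by simp
  then show "t = \<zero> B T" using comp_reduce[OF tm, of v] t m v by simp
qed

lemma pullback_graph:
  assumes pb: "is_pullback C A B Z f g E p q"
    and Q: "is_product C A B Q \<pi> \<rho>" and P: "is_product C Z B P \<pi>' \<rho>'"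
    and F: "F \<in> Hom Q P" "\<pi>' \<cdot> F = f \<cdot> \<pi>" "\<rho>' \<cdot> F = \<rho>"
    and \<gamma>: "\<gamma> \<in> Hom B P" "\<pi>' \<cdot> \<gamma> = g" "\<rho>' \<cdot> \<gamma> = \<one> B"
    and k: "k \<in> Hom E Q" "\<pi> \<cdot> k = p" "\<rho> \<cdot> k = q"
  shows "is_pullback C Q B P F \<gamma> E k q"
proof (rule is_pullbackI[OF F(1) \<gamma>(1) k(1)])
  note homs = pullback_in_hom[OF pb] and comm = pullback_comp[OF pb]
    and pQ = product_in_hom[OF Q] and pP = product_in_hom[OF P]
    and eqs = comp_reduce[OF F(2)] comp_reduce[OF F(3)] comp_reduce[OF \<gamma>(2)] comp_reduce[OF \<gamma>(3)]
  show "q \<in> Hom E B" by (fact homs)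
  show "F \<cdot> k = \<gamma> \<cdot> q"
    using product_eqI[OF P, of "F \<cdot> k" E "\<gamma> \<cdot> q"] comm k pQ pP F \<gamma> homs eqs by simp
  fix T x y assume xy: "x \<in> Hom T Q" "y \<in> Hom T B" "F \<cdot> x = \<gamma> \<cdot> y"
  have "\<pi>' \<cdot> F \<cdot> x = \<pi>' \<cdot> \<gamma> \<cdot> y" "\<rho>' \<cdot> F \<cdot> x = \<rho>' \<cdot> \<gamma> \<cdot> y" using xy(3) by simp_all
  then have "f \<cdot> \<pi> \<cdot> x = g \<cdot> y" and \<rho>x: "\<rho> \<cdot> x = y" using xy(1,2) F \<gamma> homs pQ pP eqs by simp_all
  moreover have "\<pi> \<cdot> x \<in> Hom T A" using xy pQ by simp
  ultimately obtain u where u: "u \<in> Hom T E" "p \<cdot> u = \<pi> \<cdot> x" "q \<cdot> u = y"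
    using pullback_lift[OF pb _ xy(2)] by blast
  then have "k \<cdot> u = x"
    using product_eqI[OF Q, of "k \<cdot> u" T x] \<rho>x xy k pQ comp_reduce[OF k(2), of u]
      comp_reduce[OF k(3), of u] by simp
  with u show "\<exists>u\<in>Hom T E. k \<cdot> u = x \<and> q \<cdot> u = y" by blast
next
  fix T u v assume uv: "u \<in> Hom T E" "v \<in> Hom T E" "k \<cdot> u = k \<cdot> v" "q \<cdot> u = q \<cdot> v"
  then have "\<pi> \<cdot> k \<cdot> u = \<pi> \<cdot> k \<cdot> v" by simp
  then have "p \<cdot> u = p \<cdot> v" using comp_reduce[OF k(2)] product_in_hom[OF Q] k(1) uv(1,2) by simp
  then show "u = v" using pullback_eqI[OF pb uv(1,2)] uv(4) by blast
qed

lemma product_map_epi: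
  assumes Q: "biproduct C A B Q i j \<pi> \<rho>" and P: "biproduct C Z B P i' j' \<pi>' \<rho>'"
    and F: "F \<in> Hom Q P" "\<pi>' \<cdot> F = f \<cdot> \<pi>" "\<rho>' \<cdot> F = \<rho>"
    and "epi C f" and f: "f \<in> Hom A Z"
  shows "epi C F"
proof -
  note homsQ = biproduct_in_hom[OF Q] and homsP = biproduct_in_hom[OF P]
    and compQ = biproduct_comp[OF Q] and compP = biproduct_comp[OF P]
    and eqs = comp_reduce[OF F(2)] comp_reduce[OF F(3)]
  have Fi: "F \<cdot> i = i' \<cdot> f"
    using product_eqI[OF biproduct_product[OF P], of "F \<cdot> i" A "i' \<cdot> f"]
      F(1) f homsQ homsP compQ compP eqs
      comp_reduce[OF compP(1), of f] comp_reduce[OF compP(4), of f] by simp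
  have Fj: "F \<cdot> j = j'"
    using product_eqI[OF biproduct_product[OF P], of "F \<cdot> j" B j']
      F(1) f homsQ homsP compQ compP eqs by simp
  have "a = b" if ab: "a \<in> Hom P T" "b \<in> Hom P T" "a \<cdot> F = b \<cdot> F" for T a b
  proof (rule coproduct_eqI[OF biproduct_coproduct[OF P] ab(1,2)])
    have "(a \<cdot> F) \<cdot> i = (b \<cdot> F) \<cdot> i" "(a \<cdot> F) \<cdot> j = (b \<cdot> F) \<cdot> j" using ab(3) by simp_all
    then have "(a \<cdot> i') \<cdot> f = (b \<cdot> i') \<cdot> f" "a \<cdot> j' = b \<cdot> j'"
      using ab(1,2) F(1) f homsQ homsP Fi Fj by simp_all
    then show "a \<cdot> i' = b \<cdot> i'" "a \<cdot> j' = b \<cdot> j'"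
      using epiD[OF \<open>epi C f\<close> f, of "a \<cdot> i'" T "b \<cdot> i'"] ab(1,2) homsP by simp_all
  qed
  then show ?thesis using epi_iff[OF F(1)] by blast
qed

text \<open>The pullback of \<open>f\<close> along \<open>g\<close> is also the pullback of \<open>F = f \<times> B\<close> along the graph \<open>\<gamma>\<close> of \<open>g\<close>,
  which is a monomorphism.\<close>

lemma pullback_epi:
  assumes pb: "is_pullback C A B Z f g E p q" and "epi C f"
  shows "epi C q"
proof -
  note homs = pullback_in_hom[OF pb]
  have obj: "A \<in> c_obj C" "B \<in> c_obj C" "Z \<in> c_obj C" using homs by simp_all
  obtain Q i j \<pi> \<rho> where Q: "biproduct C A B Q i j \<pi> \<rho>" using biproduct_ex obj by metis
  obtain P i' j' \<pi>' \<rho>' where P: "biproduct C Z B P i' j' \<pi>' \<rho>'" using biproduct_ex obj by metis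
  note prodQ = biproduct_product[OF Q] and homsQ = biproduct_in_hom[OF Q]
    and prodP = biproduct_product[OF P] and homsP = biproduct_in_hom[OF P]
  obtain F where F: "F \<in> Hom Q P" "\<pi>' \<cdot> F = f \<cdot> \<pi>" "\<rho>' \<cdot> F = \<rho>"
    using product_pair[OF prodP, of "f \<cdot> \<pi>" Q \<rho>] homs homsQ by auto
  obtain \<gamma> where \<gamma>: "\<gamma> \<in> Hom B P" "\<pi>' \<cdot> \<gamma> = g" "\<rho>' \<cdot> \<gamma> = \<one> B"
    using product_pair[OF prodP homs(2), of "\<one> B"] obj by auto
  obtain k where k: "k \<in> Hom E Q" "\<pi> \<cdot> k = p" "\<rho> \<cdot> k = q" using product_pair[OF prodQ homs(3,4)] .
  have "is_pullback C Q B P F \<gamma> E k q" using pullback_graph[OF pb prodQ prodP F \<gamma> k] .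
  moreover have "epi C F" using product_map_epi[OF Q P F \<open>epi C f\<close> homs(1)] .
  moreover have "mono C \<gamma>" using mono_if_retraction \<gamma>(1,3) homsP(4) by blast
  ultimately show ?thesis by (rule pullback_along_mono_epi)
qed

lemma pullback_short_exact:
  assumes pb: "is_pullback C A B Z f g E p q" and se: "short_exact C X A Z a f"
  obtains k where "short_exact C X E B k q" "p \<cdot> k = a"
proof -
  note homs = pullback_in_hom[OF pb] and a = short_exact_in_hom(1)[OF se]
  have "epi C q" using pullback_epi[OF pb short_exact_epi[OF se]] .
  have "\<zero> X B \<in> Hom X B" "f \<cdot> a = g \<cdot> \<zero> X B" using homs a short_exact_comp[OF se] by simp_all
  then obtain k where k: "k \<in> Hom X E" "p \<cdot> k = a" "q \<cdot> k = \<zero> X B"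
    using pullback_lift[OF pb a] by blast
  have "is_kernel C q k"
    unfolding kernel_iff[OF homs(4) k(1)]
  proof (intro conjI allI ballI impI)
    show "mono C k" using mono_if_mono_comp[OF _ k(1) homs(3)] k(2) short_exact_mono[OF se] by simp
    fix T t assume t: "t \<in> Hom T E" "q \<cdot> t = \<zero> T B"
    have "p \<cdot> t \<in> Hom T A" "f \<cdot> p \<cdot> t = \<zero> T Z"
      using comp_reduce[OF pullback_comp[OF pb], of t] t homs by simp_all
    then obtain x where x: "x \<in> Hom T X" "a \<cdot> x = p \<cdot> t" using short_exact_lift[OF se] by metis
    then have "k \<cdot> x = t"
      using pullback_eqI[OF pb, of "k \<cdot> x" T t] comp_reduce[OF k(2), of x]
        comp_reduce[OF k(3), of x] k(1) t homs by simp
    with x show "\<exists>u\<in>Hom T X. k \<cdot> u = t" by blast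
  qed (fact k(3))
  then have "short_exact C X E B k q" using short_exact_if_kernel \<open>epi C q\<close> k(1) homs(4) by blast
  with k(2) show thesis using that by blast
qed

lemma short_exact_pullback_cross:
  assumes se: "short_exact C X Y Z f g" and se': "short_exact C X' Y' Z f' g'"
  obtains E k q k' q' where "short_exact C X E Y' k q" "short_exact C X' E Y k' q'"
proof -
  obtain E p q where pb: "is_pullback C Y Y' Z g g' E p q"
    using pullback_ex[OF short_exact_in_hom(2)[OF se] short_exact_in_hom(2)[OF se']] .
  show thesis
    using pullback_short_exact[OF pb se] pullback_short_exact[OF is_pullback_swap[OF pb] se'] that
    by metis
qed

lemma short_exact_pushout_cross:
  assumes "short_exact C X Y Z f g" "short_exact C X Y' Z' f' g'"
  obtains E k q k' q' where "short_exact C Y' E Z k q" "short_exact C Y E Z' k' q'"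
  using abelian_category.short_exact_pullback_cross[OF dual, of Z Y X g f Z' Y' g' f'] assms that
  unfolding short_exact_op_cat by metis

lemma short_exact_comp_epi:
  assumes se: "short_exact C V Y X v p" and se': "short_exact C Z' X Z h g"
  obtains K a b k where "short_exact C K Y Z a (g \<cdot> p)" "short_exact C V K Z' k b" "a \<cdot> k = v"
proof -
  note pg = short_exact_in_hom(2)[OF se] short_exact_in_hom(2)[OF se']
  obtain K a b where pb: "is_pullback C Y Z' X p h K a b"
    using pullback_ex[OF pg(1) short_exact_in_hom(1)[OF se']] .
  have "is_kernel C (g \<cdot> p) a" using pullback_kernel[OF pb short_exact_kernel[OF se'] pg(2)] .
  moreover have "epi C (g \<cdot> p)"
    using epi_comp[OF short_exact_epi[OF se] short_exact_epi[OF se'] pg] .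
  moreover have "g \<cdot> p \<in> Hom Y Z" using pg by simp
  ultimately have "short_exact C K Y Z a (g \<cdot> p)"
    using short_exact_if_kernel pullback_in_hom(3)[OF pb] by blast
  then show thesis using pullback_short_exact[OF pb se] that by metis
qed

text \<open>The comparison morphism into the pullback is invertible by the short five lemma.\<close>

lemma pullback_if_short_exact_morphism:
  assumes se: "short_exact C X A Z a f" and se': "short_exact C X E B k q"
    and p: "p \<in> Hom E A" "p \<cdot> k = a" and g: "g \<in> Hom B Z" "f \<cdot> p = g \<cdot> q"
  shows "is_pullback C A B Z f g E p q"
proof -
  note kq = short_exact_in_hom[OF se']
  obtain E' p' q' where pb: "is_pullback C A B Z f g E' p' q'"
    using pullback_ex[OF short_exact_in_hom(2)[OF se] g(1)] .
  obtain k' where k': "short_exact C X E' B k' q'" "p' \<cdot> k' = a"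
    using pullback_short_exact[OF pb se] .
  obtain h where h: "h \<in> Hom E E'" "p' \<cdot> h = p" "q' \<cdot> h = q"
    using pullback_lift[OF pb p(1) kq(2) g(2)] .
  have "h \<cdot> k = k'"
    using pullback_eqI[OF pb, of "h \<cdot> k" X k'] comp_reduce[OF h(2), of k] comp_reduce[OF h(3), of k]
      h(1) kq short_exact_in_hom(1)[OF k'(1)] pullback_in_hom[OF pb] p(2) k'(2)
      short_exact_comp[OF se'] short_exact_comp[OF k'(1)] by simp
  then obtain h' where h': "h' \<in> Hom E' E" "h' \<cdot> h = \<one> E" "h \<cdot> h' = \<one> E'"
    using short_five[OF se' k'(1) h(1)] h(3) by blast
  then show ?thesis using is_pullback_iso[OF pb h(1) h'] h(2,3) by simp
qed


section \<open>Vanishing of Ext\<close>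

lemma Ext1_zero_retraction:
  assumes "Ext1_zero C A B" "short_exact C B E A f g"
  obtains r where "r \<in> Hom E B" "r \<cdot> f = \<one> B"
  using assms unfolding Ext1_zero_def by blast

lemma Ext1_zero_section:
  assumes "Ext1_zero C A B" "short_exact C B E A f g"
  obtains s where "s \<in> Hom A E" "g \<cdot> s = \<one> A"
  using Ext1_zero_retraction[OF assms] biproduct_if_retraction[OF assms(2)]
    biproduct_in_hom biproduct_comp by metis

lemma Ext1_zeroI:
  assumes "\<And>E f g. short_exact C B E A f g \<Longrightarrow> \<exists>s\<in>Hom A E. g \<cdot> s = \<one> A"
  shows "Ext1_zero C A B"
  unfolding Ext1_zero_def using assms biproduct_if_section biproduct_in_hom biproduct_comp by metis

lemma Ext1_zero_op_cat [simp]: "Ext1_zero (op_cat C) B A \<longleftrightarrow> Ext1_zero C A B"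
proof -
  have "Ext1_zero (op_cat C) B A \<longleftrightarrow>
      (\<forall>E f g. short_exact C B E A f g \<longrightarrow> (\<exists>s\<in>Hom A E. g \<cdot> s = \<one> A))"
    unfolding Ext1_zero_def short_exact_op_cat by auto
  also have "\<dots> \<longleftrightarrow> Ext1_zero C A B"
    using Ext1_zeroI Ext1_zero_section by metis
  finally show ?thesis .
qed

lemma lift_if_Ext1_zero:
  assumes se: "short_exact C A Y Z f g" and "Ext1_zero C W A" and h: "h \<in> Hom W Z"
  obtains l where "l \<in> Hom W Y" "g \<cdot> l = h"
proof -
  obtain E p q where pb: "is_pullback C Y W Z g h E p q"
    using pullback_ex[OF short_exact_in_hom(2)[OF se] h] .
  note homs = pullback_in_hom[OF pb]
  obtain k where "short_exact C A E W k q" using pullback_short_exact[OF pb se] .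
  then obtain s where s: "s \<in> Hom W E" "q \<cdot> s = \<one> W" using Ext1_zero_section[OF assms(2)] by blast
  then have "p \<cdot> s \<in> Hom W Y" "g \<cdot> p \<cdot> s = h"
    using comp_reduce[OF pullback_comp[OF pb], of s] homs by simp_all
  then show thesis by (rule that)
qed

lemma extend_if_Ext1_zero:
  assumes "short_exact C A Y Z f g" "Ext1_zero C Z B" "h \<in> Hom A B"
  obtains l where "l \<in> Hom Y B" "l \<cdot> f = h"
  using abelian_category.lift_if_Ext1_zero[OF dual, of Z Y A g f B h] assms
  unfolding short_exact_op_cat Ext1_zero_op_cat hom_op_cat op_cat_sel by blast

lemma Ext1_zero_iff_lift:
  assumes se: "short_exact C A Y Z f g" and WY: "Ext1_zero C W Y"
  shows "Ext1_zero C W A \<longleftrightarrow> (\<forall>h\<in>Hom W Z. \<exists>l\<in>Hom W Y. g \<cdot> l = h)"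
proof
  assume "Ext1_zero C W A"
  then show "\<forall>h\<in>Hom W Z. \<exists>l\<in>Hom W Y. g \<cdot> l = h" using lift_if_Ext1_zero[OF se] by metis
next
  assume lift: "\<forall>h\<in>Hom W Z. \<exists>l\<in>Hom W Y. g \<cdot> l = h"
  note fg = short_exact_in_hom[OF se]
  show "Ext1_zero C W A"
  proof (rule Ext1_zeroI)
    fix E a e assume se': "short_exact C A E W a e"
    note ae = short_exact_in_hom[OF se']
    obtain p where p: "p \<in> Hom E Y" "p \<cdot> a = f" using extend_if_Ext1_zero[OF se' WY fg(1)] .
    have "g \<cdot> p \<in> Hom E Z" "(g \<cdot> p) \<cdot> a = \<zero> A Z" using p fg ae short_exact_comp[OF se] by simp_all
    then obtain h where h: "h \<in> Hom W Z" "h \<cdot> e = g \<cdot> p" using short_exact_factor[OF se'] by blast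
    have pb: "is_pullback C Y W Z g h E p e"
      using pullback_if_short_exact_morphism[OF se se' p h(1)] h(2) by simp
    obtain l where l: "l \<in> Hom W Y" "g \<cdot> l = h" using lift h(1) by blast
    have "\<one> W \<in> Hom W W" "g \<cdot> l = h \<cdot> \<one> W" using l(2) h(1) by simp_all
    then show "\<exists>s\<in>Hom W E. e \<cdot> s = \<one> W" using pullback_lift[OF pb l(1)] by blast
  qed
qed

lemma Ext1_zero_extension_left:
  assumes se: "short_exact C X Y Z f g" and XB: "Ext1_zero C X B" and ZB: "Ext1_zero C Z B"
  shows "Ext1_zero C Y B"
  unfolding Ext1_zero_def
proof (intro allI impI)
  fix E b e assume se': "short_exact C B E Y b e"
  obtain K a k c where aK: "short_exact C K E Z a (g \<cdot> e)" and kK: "short_exact C B K X k c"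
    and "a \<cdot> k = b"
    using short_exact_comp_epi[OF se' se] .
  obtain r where r: "r \<in> Hom K B" "r \<cdot> k = \<one> B" using Ext1_zero_retraction[OF XB kK] .
  obtain r' where r': "r' \<in> Hom E B" "r' \<cdot> a = r" using extend_if_Ext1_zero[OF aK ZB r(1)] .
  have "r' \<cdot> b = \<one> B"
    using comp_reduce[OF r'(2), of k] r r' \<open>a \<cdot> k = b\<close> short_exact_in_hom[OF aK]
      short_exact_in_hom[OF kK] by simp
  with r'(1) show "\<exists>r\<in>Hom E B. r \<cdot> b = \<one> B" by blast
qed

lemma Ext1_zero_extension_right:
  "short_exact C X Y Z f g \<Longrightarrow> Ext1_zero C W X \<Longrightarrow> Ext1_zero C W Z \<Longrightarrow> Ext1_zero C W Y"
  using abelian_category.Ext1_zero_extension_left[OF dual, of Z Y X g f W] by simp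

lemma Ext1_zero_retract_left:
  assumes i: "i \<in> Hom N Y" and p: "p \<in> Hom Y N" and "p \<cdot> i = \<one> N" and YB: "Ext1_zero C Y B"
  shows "Ext1_zero C N B"
proof (rule Ext1_zeroI)
  fix E b e assume se: "short_exact C B E N b e"
  obtain l where l: "l \<in> Hom Y E" "e \<cdot> l = p" using lift_if_Ext1_zero[OF se YB p] .
  then have "l \<cdot> i \<in> Hom N E" "e \<cdot> l \<cdot> i = \<one> N"
    using comp_reduce[OF l(2), of i] short_exact_in_hom[OF se] i \<open>p \<cdot> i = \<one> N\<close> by simp_all
  then show "\<exists>s\<in>Hom N E. e \<cdot> s = \<one> N" by blast
qed

lemma Ext1_zero_retract_right:
  "i \<in> Hom N Y \<Longrightarrow> p \<in> Hom Y N \<Longrightarrow> p \<cdot> i = \<one> N \<Longrightarrow> Ext1_zero C W Y \<Longrightarrow> Ext1_zero C W N"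
  using abelian_category.Ext1_zero_retract_left[OF dual, of p N Y i W] by simp


section \<open>Isomorphisms and direct sums\<close>

lemma isomorphicI:
  assumes "h \<in> Hom X Y" "h' \<in> Hom Y X" "h' \<cdot> h = \<one> X" "h \<cdot> h' = \<one> Y"
  shows "isomorphic C X Y"
proof -
  have "h' \<in> Hom (c_cod C h) (c_dom C h)" "h' \<cdot> h = \<one> (c_dom C h)" "h \<cdot> h' = \<one> (c_cod C h)"
    "h \<in> c_arr C"
    using assms by simp_all
  then show ?thesis using assms(1) unfolding isomorphic_def iso_mor_def by blast
qed

lemma isomorphicE:
  assumes "isomorphic C X Y"
  obtains h h' where "h \<in> Hom X Y" "h' \<in> Hom Y X" "h' \<cdot> h = \<one> X" "h \<cdot> h' = \<one> Y"
proof -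
  obtain h h' where h: "h \<in> Hom X Y" and "h' \<in> Hom (c_cod C h) (c_dom C h)"
    "h' \<cdot> h = \<one> (c_dom C h)" "h \<cdot> h' = \<one> (c_cod C h)"
    using assms unfolding isomorphic_def iso_mor_def by blast
  then have "h' \<in> Hom Y X" "h' \<cdot> h = \<one> X" "h \<cdot> h' = \<one> Y" by simp_all
  with h show thesis by (rule that)
qed

lemma isomorphic_refl: "X \<in> c_obj C \<Longrightarrow> isomorphic C X X"
  using isomorphicI[of "\<one> X" X X "\<one> X"] by simp

lemma isomorphic_sym: "isomorphic C X Y \<Longrightarrow> isomorphic C Y X"
  using isomorphicE isomorphicI by metis

lemma isomorphic_trans:
  assumes "isomorphic C X Y" "isomorphic C Y Z"
  shows "isomorphic C X Z"
proof -
  obtain f f' where f: "f \<in> Hom X Y" "f' \<in> Hom Y X" "f' \<cdot> f = \<one> X" "f \<cdot> f' = \<one> Y"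
    using isomorphicE[OF assms(1)] .
  obtain g g' where g: "g \<in> Hom Y Z" "g' \<in> Hom Z Y" "g' \<cdot> g = \<one> Y" "g \<cdot> g' = \<one> Z"
    using isomorphicE[OF assms(2)] .
  show ?thesis
    using f g comp_reduce[OF g(3), of f] comp_reduce[OF f(4), of g']
    by (intro isomorphicI[of "g \<cdot> f" X Z "f' \<cdot> g'"]) simp_all
qed

lemma kernel_isomorphic:
  assumes "f \<in> Hom Y Z" "k \<in> Hom K Y" "k' \<in> Hom K' Y" "is_kernel C f k" "is_kernel C f k'"
  shows "isomorphic C K K'"
proof -
  note ker = kernel_iff[OF assms(1,2)] and ker' = kernel_iff[OF assms(1,3)]
  have "mono C k" "mono C k'" using assms(4,5) ker ker' by blast+
  obtain a where a: "a \<in> Hom K K'" "k' \<cdot> a = k" using assms(2,4,5) ker ker' by blast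
  obtain b where b: "b \<in> Hom K' K" "k \<cdot> b = k'" using assms(3,4,5) ker ker' by blast
  have "b \<cdot> a = \<one> K"
    using monoD[OF \<open>mono C k\<close> assms(2), of "b \<cdot> a" K "\<one> K"] comp_reduce[OF b(2), of a] a b
      assms(2) by simp
  moreover have "a \<cdot> b = \<one> K'"
    using monoD[OF \<open>mono C k'\<close> assms(3), of "a \<cdot> b" K' "\<one> K'"] comp_reduce[OF a(2), of b] a b
      assms(3) by simp
  ultimately show ?thesis using isomorphicI a(1) b(1) by blast
qed

lemma coproduct_isomorphic:
  assumes S: "is_coproduct C A B S i j" and S': "is_coproduct C A B S' i' j'"
  shows "isomorphic C S S'"
proof -
  note ij = coproduct_in_hom[OF S] and ij' = coproduct_in_hom[OF S']
  obtain h where h: "h \<in> Hom S S'" "h \<cdot> i = i'" "h \<cdot> j = j'" using coproduct_copair[OF S ij'] .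
  obtain h' where h': "h' \<in> Hom S' S" "h' \<cdot> i' = i" "h' \<cdot> j' = j" using coproduct_copair[OF S' ij] .
  have "h' \<cdot> h = \<one> S" using coproduct_eqI[OF S, of "h' \<cdot> h" S "\<one> S"] h h' ij by simp
  moreover have "h \<cdot> h' = \<one> S'" using coproduct_eqI[OF S', of "h \<cdot> h'" S' "\<one> S'"] h h' ij' by simp
  ultimately show ?thesis using isomorphicI h(1) h'(1) by blast
qed

lemma direct_sum_isomorphic: "direct_sum C A B S \<Longrightarrow> direct_sum C A B S' \<Longrightarrow> isomorphic C S S'"
  unfolding direct_sum_def using coproduct_isomorphic biproduct_coproduct by metis

lemma direct_sum_zero_obj:
  assumes "isomorphic C X Y" "zero_obj C Z"
  shows "direct_sum C X Z Y"
proof -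
  obtain h h' where h: "h \<in> Hom X Y" "h' \<in> Hom Y X" "h' \<cdot> h = \<one> X" "h \<cdot> h' = \<one> Y"
    using isomorphicE[OF assms(1)] .
  have Z: "Z \<in> c_obj C" using assms(2) by (simp add: zero_obj_def)
  have "is_coproduct C X Z X (\<one> X) (\<zero> Z X)"
    unfolding is_coproduct_def
  proof (intro conjI allI impI)
    show "X \<in> c_obj C" "\<one> X \<in> Hom X X" "\<zero> Z X \<in> Hom Z X" using h(1) Z by simp_all
    fix T f g assume fg: "f \<in> Hom X T \<and> g \<in> Hom Z T"
    then have "f \<cdot> \<zero> Z X \<in> Hom Z T" using Z h(1) by simp
    then have "f \<cdot> \<zero> Z X = g" using zero_obj_initial[OF assms(2)] fg in_hom_iff by metis
    then show "\<exists>!u. u \<in> Hom X T \<and> u \<cdot> \<one> X = f \<and> u \<cdot> \<zero> Z X = g"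
      using fg comp_id in_hom_iff by metis
  qed
  then show ?thesis using is_coproduct_iso h direct_sum_if_coproduct by metis
qed

lemma direct_sum_if_section:
  "short_exact C X Y Z f g \<Longrightarrow> s \<in> Hom Z Y \<Longrightarrow> g \<cdot> s = \<one> Z \<Longrightarrow> direct_sum C X Z Y"
  unfolding direct_sum_def using biproduct_if_section by metis

lemma direct_sum_if_Ext1_zero:
  assumes "short_exact C X Y Z f g" "Ext1_zero C Z X"
  shows "direct_sum C X Z Y"
  using Ext1_zero_section[OF assms(2,1)] direct_sum_if_section[OF assms(1)] by metis

lemma Ext1_zero_summand:
  assumes "direct_sum C N W M"
  shows "Ext1_zero C M B \<Longrightarrow> Ext1_zero C N B" "Ext1_zero C A M \<Longrightarrow> Ext1_zero C A N"
proof -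
  obtain i j p q where "biproduct C N W M i j p q" using assms unfolding direct_sum_def by blast
  note homs = biproduct_in_hom(1,3)[OF this] and pi = biproduct_comp(1)[OF this]
  show "Ext1_zero C M B \<Longrightarrow> Ext1_zero C N B" using Ext1_zero_retract_left[OF homs pi] .
  show "Ext1_zero C A M \<Longrightarrow> Ext1_zero C A N" using Ext1_zero_retract_right[OF homs pi] .
qed

end


section \<open>Periodic points of a relation\<close>

definition periodic_points :: "'a rel \<Rightarrow> nat \<Rightarrow> 'a set" where
  "periodic_points R m = {x. (x, x) \<in> R ^^ m}"

lemma relpow_change_ends:
  fixes R :: "'a rel"
  assumes "(x, y) \<in> R ^^ m" "m \<ge> 1"
    and "\<And>z. (x, z) \<in> R \<Longrightarrow> (x', z) \<in> R" "\<And>z. (z, y) \<in> R \<Longrightarrow> (z, y') \<in> R"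
  shows "(x', y') \<in> R ^^ m"
proof -
  obtain n where m: "m = Suc n" using assms(2) by (cases m) auto
  obtain z where "(x, z) \<in> R" "(z, y) \<in> R ^^ n" using assms(1) m relpow_Suc_D2 by metis
  then have "(x', y) \<in> R ^^ Suc n" using assms(3) relpow_Suc_I2 by metis
  then obtain w where "(x', w) \<in> R ^^ n" "(w, y) \<in> R" by auto
  then show ?thesis using assms(4) m by auto
qed

lemma periodic_points_predecessor:
  assumes "x \<in> periodic_points R m" "m \<ge> 1"
  obtains y where "y \<in> periodic_points R m" "(y, x) \<in> R"
proof -
  obtain n where m: "m = Suc n" using assms(2) by (cases m) auto
  obtain y where y: "(x, y) \<in> R ^^ n" "(y, x) \<in> R"
    using assms(1) m by (auto simp: periodic_points_def)
  then have "(y, y) \<in> R ^^ Suc n" using relpow_Suc_I2 by metis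
  then show thesis using y that m by (simp add: periodic_points_def)
qed

lemma periodic_points_converse: "periodic_points (R\<inverse>) m = periodic_points R m"
proof -
  have "(R\<inverse>) ^^ m = (R ^^ m)\<inverse>"
  proof (induction m)
    case (Suc m)
    then show ?case by (metis converse_relcomp relpow.simps(2) relpow_commute)
  qed auto
  then show ?thesis by (simp add: periodic_points_def)
qed

lemma relpow_if_descending:
  fixes c :: "int \<Rightarrow> 'a"
  assumes "\<And>n. (c n, c (n - 1)) \<in> R"
  shows "(c (int j), c 0) \<in> R ^^ j"
proof (induction j)
  case (Suc j)
  have "(c (int (Suc j)), c (int j)) \<in> R" using assms[of "int (Suc j)"] by simp
  then show ?case using Suc relpow_Suc_I2 by metis
qed simp

lemma periodic_points_descending:
  assumes "x \<in> periodic_points R m" "m \<ge> 1"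
  obtains c :: "int \<Rightarrow> 'a" where "\<And>n. (c n, c (n - 1)) \<in> R" "\<And>i. c (i * int m) = x"
proof -
  obtain z where z: "z 0 = x" "z m = x" "\<And>i. i < m \<Longrightarrow> (z i, z (Suc i)) \<in> R"
    using assms(1) unfolding periodic_points_def relpow_fun_conv by auto
  define c where "c n = z (nat ((- n) mod int m))" for n
  have "(c n, c (n - 1)) \<in> R" for n
  proof -
    define a where "a = nat ((- n) mod int m)"
    have a: "int a = (- n) mod int m" "a < m" using assms(2) by (auto simp: a_def nat_less_iff)
    have "(- (n - 1)) mod int m = ((- n) mod int m + 1) mod int m"
      by (simp add: mod_simps add.commute)
    then have "(- (n - 1)) mod int m = int (Suc a) mod int m" using a by (simp add: add.commute)
    then have "nat ((- (n - 1)) mod int m) = Suc a mod m" by (metis nat_int zmod_int)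
    then have "c (n - 1) = z (Suc a)" using a(2) z(1,2) by (cases "Suc a = m") (auto simp: c_def)
    then show ?thesis using z(3)[OF a(2)] by (simp add: c_def a_def)
  qed
  moreover have "c (i * int m) = x" for i
    using z by (simp add: c_def mod_minus_eq[symmetric] flip: mult_minus_left)
  ultimately show thesis using that by blast
qed


section \<open>Exact complexes spliced from short exact sequences\<close>

definition spliced ::
  "('o,'m) category \<Rightarrow> (int \<Rightarrow> 'o) \<Rightarrow> (int \<Rightarrow> 'm) \<Rightarrow> (int \<Rightarrow> 'o) \<Rightarrow> (int \<Rightarrow> 'm) \<Rightarrow> (int \<Rightarrow> 'm) \<Rightarrow> bool" where
  "spliced C X d c k u \<longleftrightarrow>
     (\<forall>n. short_exact C (c n) (X n) (c (n - 1)) (k n) (u n) \<and> d n = c_comp C (k (n - 1)) (u n))"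

context abelian_category
begin

lemma
  assumes "spliced C X d c k u"
  shows spliced_short_exact: "short_exact C (c n) (X n) (c (n - 1)) (k n) (u n)"
    and spliced_short_exact_Suc:
      "short_exact C (c (n + 1)) (X (n + 1)) (c n) (k (n + 1)) (u (n + 1))"
    and spliced_differential: "d n = k (n - 1) \<cdot> u n"
    and spliced_differential_Suc: "d (n + 1) = k n \<cdot> u (n + 1)"
proof -
  have se: "\<And>n. short_exact C (c n) (X n) (c (n - 1)) (k n) (u n)"
    and d: "\<And>n. d n = k (n - 1) \<cdot> u n"
    using assms by (simp_all add: spliced_def)
  show "short_exact C (c n) (X n) (c (n - 1)) (k n) (u n)" "d n = k (n - 1) \<cdot> u n" by (fact se d)+
  show "short_exact C (c (n + 1)) (X (n + 1)) (c n) (k (n + 1)) (u (n + 1))"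
    "d (n + 1) = k n \<cdot> u (n + 1)"
    using se[of "n + 1"] d[of "n + 1"] by simp_all
qed

lemma spliced_in_hom:
  assumes "spliced C X d c k u"
  shows "k n \<in> Hom (c n) (X n)" "u n \<in> Hom (X n) (c (n - 1))" "u (n + 1) \<in> Hom (X (n + 1)) (c n)"
    "d n \<in> Hom (X n) (X (n - 1))" "d (n + 1) \<in> Hom (X (n + 1)) (X n)"
proof -
  show k: "k n \<in> Hom (c n) (X n)" for n
    by (rule short_exact_in_hom[OF spliced_short_exact[OF assms]])
  show u: "u n \<in> Hom (X n) (c (n - 1))" for n
    by (rule short_exact_in_hom[OF spliced_short_exact[OF assms]])
  show u': "u (n + 1) \<in> Hom (X (n + 1)) (c n)" using u[of "n + 1"] by simp
  show "d n \<in> Hom (X n) (X (n - 1))" "d (n + 1) \<in> Hom (X (n + 1)) (X n)"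
    using spliced_differential[OF assms, of n] spliced_differential_Suc[OF assms, of n]
      k[of n] k[of "n - 1"] u[of n] u' by simp_all
qed

lemma spliced_op_cat:
  assumes "spliced C X d c k u"
  shows "spliced (op_cat C) (\<lambda>n. X (- n)) (\<lambda>n. d (1 - n))
    (\<lambda>n. c (- n - 1)) (\<lambda>n. u (- n)) (\<lambda>n. k (- n))"
  using spliced_short_exact[OF assms] spliced_differential[OF assms, of "1 - n" for n]
  by (simp add: spliced_def)

lemma spliced_kernel:
  assumes sp: "spliced C X d c k u"
  shows "is_kernel C (d n) (k n)"
  using kernel_mono_comp_iff[OF short_exact_mono[OF spliced_short_exact[OF sp, of "n - 1"]]]
    short_exact_kernel[OF spliced_short_exact[OF sp, of n]] spliced_in_hom(1,2)[OF sp]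
  unfolding spliced_differential[OF sp, of n] by blast

lemma spliced_differential_comp:
  assumes sp: "spliced C X d c k u"
  shows "d n \<cdot> k n = \<zero> (c n) (X (n - 1))"
  using spliced_kernel[OF sp] kernel_iff[OF spliced_in_hom(4,1)[OF sp]] by blast

lemma spliced_exact_complex:
  assumes sp: "spliced C X d c k u"
  shows "exact_complex C X d"
proof -
  note homs = spliced_in_hom[OF sp]
  have dd: "zero_mor C (d n \<cdot> d (n + 1))" for n
  proof -
    have "d n \<cdot> d (n + 1) = \<zero> (X (n + 1)) (X (n - 1))"
      using comp_reduce[OF spliced_differential_comp[OF sp], of n "u (n + 1)"]
        spliced_differential_Suc[OF sp, of n] homs[of n] by simp
    then show ?thesis using zero_mor_iff[of _ "X (n + 1)" "X (n - 1)"] homs(4,5)[of n] by simp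
  qed
  have "exact_at C (d (n + 1)) (d n)" for n
    unfolding exact_at_def
  proof (intro conjI exI)
    show "is_kernel C (d n) (k n)" "k n \<cdot> u (n + 1) = d (n + 1)" "epi C (u (n + 1))"
      using spliced_kernel[OF sp] spliced_differential_Suc[OF sp, of n]
        short_exact_epi[OF spliced_short_exact[OF sp, of "n + 1"]] by simp_all
  qed (use homs[of n] dd in simp_all)
  moreover have "chain_complex C X d"
    unfolding chain_complex_def using homs(4) dd[of "n - 1" for n] by simp
  ultimately show ?thesis by (simp add: exact_complex_def)
qed

lemma exact_complex_spliced:
  assumes "exact_complex C X d"
  obtains c k u where "spliced C X d c k u"
proof -
  have d: "d n \<in> Hom (X n) (X (n - 1))" for n
    using assms unfolding exact_complex_def chain_complex_def by blast
  have "\<exists>k v. is_kernel C (d n) k \<and> v \<in> Hom (X (n + 1)) (c_dom C k) \<and>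
      k \<cdot> v = d (n + 1) \<and> epi C v" for n
  proof -
    have "c_dom C (d (n + 1)) = X (n + 1)" using d[of "n + 1"] by simp
    then show ?thesis using assms unfolding exact_complex_def exact_at_def by metis
  qed
  then obtain k v where ker: "\<And>n. is_kernel C (d n) (k n)"
    and v: "\<And>n. v n \<in> Hom (X (n + 1)) (c_dom C (k n))" "\<And>n. k n \<cdot> v n = d (n + 1)" "\<And>n. epi C (v n)"
    by metis
  define c where "c n = c_dom C (k n)" for n
  define u where "u n = v (n - 1)" for n
  have k: "k n \<in> Hom (c n) (X n)" for n using kernel_in_hom[OF ker d] by (simp add: c_def)
  have u: "u n \<in> Hom (X n) (c (n - 1))" "d n = k (n - 1) \<cdot> u n" "epi C (u n)" for n
    using v[of "n - 1"] by (simp_all add: c_def u_def)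
  have "mono C (k n)" for n using kernel_iff[OF d k] ker by blast
  then have "is_kernel C (u n) (k n)" for n
    using kernel_mono_comp_iff k u(1,2) ker by metis
  then have "spliced C X d c k u"
    unfolding spliced_def using short_exact_if_kernel k u by blast
  then show thesis by (rule that)
qed

lemma spliced_cycle_iso_iff:
  assumes sp: "spliced C X d c k u"
  shows "cycle_iso C X d n M \<longleftrightarrow> isomorphic C (c n) M"
proof
  note homs = spliced_in_hom[OF sp, of n]
  assume "cycle_iso C X d n M"
  then obtain k' where k': "is_kernel C (d n) k'" "isomorphic C (c_dom C k') M"
    unfolding cycle_iso_def by blast
  then have "isomorphic C (c n) (c_dom C k')"
    using kernel_isomorphic[OF homs(4,1) kernel_in_hom[OF _ homs(4)] spliced_kernel[OF sp]] by blast
  then show "isomorphic C (c n) M" using isomorphic_trans k'(2) by blast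
next
  assume "isomorphic C (c n) M"
  moreover have "c_dom C (k n) = c n" using spliced_in_hom(1)[OF sp, of n] by simp
  ultimately show "cycle_iso C X d n M" unfolding cycle_iso_def using spliced_kernel[OF sp] by metis
qed

lemma spliced_hom_from_acyclic_iff_lift:
  assumes sp: "spliced C X d c k u"
  shows "hom_from_acyclic C W X d \<longleftrightarrow>
    (\<forall>n. \<forall>h\<in>Hom W (c n). \<exists>l\<in>Hom W (X (n + 1)). u (n + 1) \<cdot> l = h)"
proof -
  note homs = spliced_in_hom[OF sp]
  have zero_mor_iff_factor: "zero_mor C (d n \<cdot> f) \<longleftrightarrow> (\<exists>h\<in>Hom W (c n). k n \<cdot> h = f)"
    if f: "f \<in> Hom W (X n)" for n f
  proof -
    have "d n \<cdot> f \<in> Hom W (X (n - 1))" using f homs(4)[of n] by simp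
    then have "zero_mor C (d n \<cdot> f) \<longleftrightarrow> d n \<cdot> f = \<zero> W (X (n - 1))" by (rule zero_mor_iff)
    moreover have "d n \<cdot> k n \<cdot> h = \<zero> W (X (n - 1))" if "h \<in> Hom W (c n)" for h
      using comp_reduce[OF spliced_differential_comp[OF sp], of n h] homs[of n] that by simp
    ultimately show ?thesis using kernel_iff[OF homs(4,1)] spliced_kernel[OF sp] f by blast
  qed
  have lift_iff: "d (n + 1) \<cdot> l = k n \<cdot> h \<longleftrightarrow> u (n + 1) \<cdot> l = h"
    if "h \<in> Hom W (c n)" "l \<in> Hom W (X (n + 1))" for n h l
    using short_exact_mono[OF spliced_short_exact[OF sp]]
      monoD[OF _ homs(1), of n "u (n + 1) \<cdot> l" W h]
      spliced_differential_Suc[OF sp, of n] homs[of n] that by auto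
  have "hom_from_acyclic C W X d \<longleftrightarrow>
      (\<forall>n. \<forall>h\<in>Hom W (c n). \<exists>l\<in>Hom W (X (n + 1)). d (n + 1) \<cdot> l = k n \<cdot> h)"
  proof -
    have "k n \<cdot> h \<in> Hom W (X n)" if "h \<in> Hom W (c n)" for n h using homs(1)[of n] that by simp
    then show ?thesis unfolding hom_from_acyclic_def using zero_mor_iff_factor by metis
  qed
  also have "\<dots> \<longleftrightarrow> (\<forall>n. \<forall>h\<in>Hom W (c n). \<exists>l\<in>Hom W (X (n + 1)). u (n + 1) \<cdot> l = h)"
    using lift_iff by blast
  finally show ?thesis .
qed

lemma spliced_hom_from_acyclic_iff_Ext1_zero:
  assumes sp: "spliced C X d c k u" and "\<And>n. Ext1_zero C W (X n)"
  shows "hom_from_acyclic C W X d \<longleftrightarrow> (\<forall>n. Ext1_zero C W (c n))"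
proof -
  have "hom_from_acyclic C W X d \<longleftrightarrow> (\<forall>n. Ext1_zero C W (c (n + 1)))"
    unfolding spliced_hom_from_acyclic_iff_lift[OF sp]
    using Ext1_zero_iff_lift[OF spliced_short_exact_Suc[OF sp] assms(2)] by blast
  also have "\<dots> \<longleftrightarrow> (\<forall>n. Ext1_zero C W (c n))" by (metis diff_add_cancel)
  finally show ?thesis .
qed

lemma hom_to_acyclic_iff_op_cat:
  "hom_to_acyclic C Y X d \<longleftrightarrow> hom_from_acyclic (op_cat C) Y (\<lambda>n. X (- n)) (\<lambda>n. d (1 - n))"
proof -
  have reindex: "(\<forall>n. P n) \<longleftrightarrow> (\<forall>n. P (- n))" for P :: "int \<Rightarrow> bool" by (metis minus_minus)
  have "hom_to_acyclic C Y X d \<longleftrightarrow> (\<forall>n. \<forall>f\<in>Hom (X (- n)) Y. zero_mor C (f \<cdot> d (- n + 1)) \<longrightarrow>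
      (\<exists>g\<in>Hom (X (- n - 1)) Y. g \<cdot> d (- n) = f))"
    unfolding hom_to_acyclic_def by (rule reindex)
  then show ?thesis by (simp add: hom_from_acyclic_def add.commute del: in_hom_iff)
qed

lemma spliced_hom_to_acyclic_iff_Ext1_zero:
  assumes sp: "spliced C X d c k u" and "\<And>n. Ext1_zero C (X n) Y"
  shows "hom_to_acyclic C Y X d \<longleftrightarrow> (\<forall>n. Ext1_zero C (c n) Y)"
proof -
  have "hom_to_acyclic C Y X d \<longleftrightarrow> (\<forall>n. Ext1_zero C (c (- n - 1)) Y)"
    unfolding hom_to_acyclic_iff_op_cat
    using abelian_category.spliced_hom_from_acyclic_iff_Ext1_zero[OF dual spliced_op_cat[OF sp]]
      assms(2) by simp
  also have "\<dots> \<longleftrightarrow> (\<forall>n. Ext1_zero C (c n) Y)" by (metis add_diff_cancel minus_diff_eq minus_minus)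
  finally show ?thesis .
qed

end


section \<open>The syzygy relation\<close>

definition perp1_between :: "('o,'m) category \<Rightarrow> 'o set \<Rightarrow> 'o set \<Rightarrow> 'o set" where
  "perp1_between C \<U> \<V> = right_perp1 C \<U> \<inter> left_perp1 C \<V>"

definition syzygy_rel :: "('o,'m) category \<Rightarrow> 'o set \<Rightarrow> 'o set \<Rightarrow> 'o set \<Rightarrow> 'o rel" where
  "syzygy_rel C \<W> \<U> \<V> = {(K, M). K \<in> perp1_between C \<U> \<V> \<and> M \<in> perp1_between C \<U> \<V> \<and>
     (\<exists>W\<in>\<W>. \<exists>f g. short_exact C K W M f g)}"

definition closed_extensions :: "('o,'m) category \<Rightarrow> 'o set \<Rightarrow> bool" where
  "closed_extensions C \<P> \<longleftrightarrow> (\<forall>X Y Z f g. short_exact C X Y Z f g \<and> X \<in> \<P> \<and> Z \<in> \<P> \<longrightarrow> Y \<in> \<P>)"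

definition kernel_criterion :: "('o,'m) category \<Rightarrow> 'o set \<Rightarrow> 'o set \<Rightarrow> bool" where
  "kernel_criterion C \<P> \<Q> \<longleftrightarrow>
     (\<forall>X Y Z f g. short_exact C X Y Z f g \<and> Y \<in> \<P> \<and> Z \<in> \<P> \<longrightarrow> (X \<in> \<P> \<longleftrightarrow> X \<in> \<Q>))"

definition cokernel_criterion :: "('o,'m) category \<Rightarrow> 'o set \<Rightarrow> 'o set \<Rightarrow> bool" where
  "cokernel_criterion C \<P> \<Q> \<longleftrightarrow>
     (\<forall>X Y Z f g. short_exact C X Y Z f g \<and> X \<in> \<P> \<and> Y \<in> \<P> \<longrightarrow> (Z \<in> \<P> \<longleftrightarrow> Z \<in> \<Q>))"

context abelian_category
begin

lemma right_perp1_op_cat [simp]: "right_perp1 (op_cat C) \<X> = left_perp1 C \<X>"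
  by (simp add: right_perp1_def left_perp1_def)

lemma left_perp1_op_cat [simp]: "left_perp1 (op_cat C) \<X> = right_perp1 C \<X>"
  by (simp add: right_perp1_def left_perp1_def)

lemma perp1_between_op_cat [simp]: "perp1_between (op_cat C) \<V> \<U> = perp1_between C \<U> \<V>"
  by (auto simp: perp1_between_def)

lemma syzygy_rel_op_cat [simp]: "syzygy_rel (op_cat C) \<W> \<V> \<U> = (syzygy_rel C \<W> \<U> \<V>)\<inverse>"
  by (auto simp: syzygy_rel_def)

lemma closed_extensions_op_cat [simp]: "closed_extensions (op_cat C) \<P> \<longleftrightarrow> closed_extensions C \<P>"
  unfolding closed_extensions_def short_exact_op_cat by blast

lemma kernel_criterion_op_cat [simp]: "kernel_criterion (op_cat C) \<P> \<Q> \<longleftrightarrow> cokernel_criterion C \<P> \<Q>"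
  unfolding kernel_criterion_def cokernel_criterion_def short_exact_op_cat by blast

lemma in_perp1_between_iff:
  "N \<in> perp1_between C \<U> \<V> \<longleftrightarrow>
     N \<in> c_obj C \<and> (\<forall>U\<in>\<U>. Ext1_zero C U N) \<and> (\<forall>V\<in>\<V>. Ext1_zero C N V)"
  by (auto simp: perp1_between_def right_perp1_def left_perp1_def)

lemma perp1_between_extension:
  assumes "short_exact C X Y Z f g" "X \<in> perp1_between C \<U> \<V>" "Z \<in> perp1_between C \<U> \<V>"
  shows "Y \<in> perp1_between C \<U> \<V>"
  using Ext1_zero_extension_left[OF assms(1)] Ext1_zero_extension_right[OF assms(1)]
    short_exact_obj(2)[OF assms(1)] assms(2,3)
  unfolding in_perp1_between_iff by blast

lemma perp1_between_summand:
  assumes "direct_sum C N W M" "M \<in> perp1_between C \<U> \<V>"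
  shows "N \<in> perp1_between C \<U> \<V>"
proof -
  have "N \<in> c_obj C"
    using assms(1) biproduct_in_hom(1) unfolding direct_sum_def by (metis in_hom_iff)
  then show ?thesis
    using Ext1_zero_summand[OF assms(1)] assms(2) unfolding in_perp1_between_iff by blast
qed

end

text \<open>The two classes \<open>\<U>\<close> and \<open>\<V>\<close> generalise the theorem's \<open>\<omega>\<close> and \<open>\<B>\<close> so that passing to the
  opposite category merely exchanges them.\<close>

locale syzygy_setting = abelian_category C for C :: "('o,'m) category" +
  fixes \<W> \<U> \<V> :: "'o set"
  assumes zero_obj_in: "zero_obj C Z \<Longrightarrow> Z \<in> \<W>"
    and direct_sum_in_iff: "direct_sum C A B S \<Longrightarrow> S \<in> \<W> \<longleftrightarrow> A \<in> \<W> \<and> B \<in> \<W>"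
    and W_obj: "\<W> \<subseteq> c_obj C" and W_subset_U: "\<W> \<subseteq> \<U>" and W_subset_V: "\<W> \<subseteq> \<V>"
    and Ext1_zero_U_W: "A \<in> \<U> \<Longrightarrow> B \<in> \<W> \<Longrightarrow> Ext1_zero C A B"
    and Ext1_zero_W_V: "A \<in> \<W> \<Longrightarrow> B \<in> \<V> \<Longrightarrow> Ext1_zero C A B"
begin

abbreviation "Perp \<equiv> perp1_between C \<U> \<V>"
abbreviation "Syz \<equiv> syzygy_rel C \<W> \<U> \<V>"

lemma dual_setting: "syzygy_setting (op_cat C) \<W> \<V> \<U>"
  unfolding syzygy_setting_def syzygy_setting_axioms_def direct_sum_op_cat zero_obj_op_cat
    Ext1_zero_op_cat
  using dual zero_obj_in direct_sum_in_iff W_obj W_subset_U W_subset_V Ext1_zero_U_W Ext1_zero_W_V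
  by simp

lemma W_subset_Perp: "\<W> \<subseteq> Perp"
  using W_obj Ext1_zero_U_W Ext1_zero_W_V by (auto simp: in_perp1_between_iff)

lemma syzygyE:
  assumes "(K, M) \<in> Syz"
  obtains W f g where "W \<in> \<W>" "short_exact C K W M f g" "K \<in> Perp" "M \<in> Perp"
  using assms by (auto simp: syzygy_rel_def)

lemma syzygyI: "short_exact C K W M f g \<Longrightarrow> W \<in> \<W> \<Longrightarrow> K \<in> Perp \<Longrightarrow> M \<in> Perp \<Longrightarrow> (K, M) \<in> Syz"
  by (auto simp: syzygy_rel_def)

lemma syzygy_drop_summand_right:
  assumes "(K, M) \<in> Syz" "direct_sum C N W M" "W \<in> \<W>"
  shows "(K, N) \<in> Syz"
proof -
  obtain E f g where E: "E \<in> \<W>" "short_exact C K E M f g" and K: "K \<in> Perp" and M: "M \<in> Perp"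
    using syzygyE[OF assms(1)] .
  note g = short_exact_in_hom(2)[OF E(2)]
  obtain i j p q where M_biprod: "biproduct C N W M i j p q"
    using assms(2) unfolding direct_sum_def by blast
  note homs = biproduct_in_hom[OF M_biprod]
  obtain L a b k where L: "short_exact C L E W a (q \<cdot> g)" "short_exact C K L N k b"
    using short_exact_comp_epi[OF E(2) biproduct_short_exact[OF M_biprod]] .
  have "Ext1_zero C W K" using K assms(3) W_subset_U by (auto simp: in_perp1_between_iff)
  then obtain l where l: "l \<in> Hom W E" "g \<cdot> l = j"
    using lift_if_Ext1_zero[OF E(2) _ homs(2)] by blast
  have "(q \<cdot> g) \<cdot> l = \<one> W" using l g homs biproduct_comp(2)[OF M_biprod] by simp
  then have "direct_sum C L W E" using direct_sum_if_section L(1) l(1) by blast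
  then have "L \<in> \<W>" using direct_sum_in_iff E(1) by blast
  then show ?thesis using syzygyI[OF L(2)] K perp1_between_summand[OF assms(2) M] by blast
qed

lemma syzygy_drop_summand_left:
  "(M, L) \<in> Syz \<Longrightarrow> direct_sum C N W M \<Longrightarrow> W \<in> \<W> \<Longrightarrow> (N, L) \<in> Syz"
  using syzygy_setting.syzygy_drop_summand_right[OF dual_setting, of L M N W] by simp

lemma syzygy_isomorphic_left:
  assumes "(M, L) \<in> Syz" "isomorphic C N M"
  shows "(N, L) \<in> Syz"
  using assms direct_sum_zero_obj syzygy_drop_summand_left zero_obj_in zero_obj_ex by metis

lemma syzygy_isomorphic_right:
  assumes "(K, M) \<in> Syz" "isomorphic C N M"
  shows "(K, N) \<in> Syz"
  using assms direct_sum_zero_obj syzygy_drop_summand_right zero_obj_in zero_obj_ex by metis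

lemma syzygy_add_summand_left:
  assumes "(N, L) \<in> Syz" "direct_sum C N W M" "W \<in> \<W>"
  shows "(M, L) \<in> Syz"
proof -
  obtain E f g where E: "E \<in> \<W>" "short_exact C N E L f g" and N: "N \<in> Perp" and L: "L \<in> Perp"
    using syzygyE[OF assms(1)] .
  have "W \<in> c_obj C" "E \<in> c_obj C" using assms(3) E(1) W_obj by auto
  then obtain E' i j p q where E': "biproduct C W E E' i j p q" using biproduct_ex by metis
  obtain K a b k where K: "short_exact C K E' L a (g \<cdot> q)" "short_exact C W K N k b"
    using short_exact_comp_epi[OF biproduct_short_exact[OF E'] E(2)] .
  have "Ext1_zero C N W" using N assms(3) W_subset_V by (auto simp: in_perp1_between_iff)
  then have "direct_sum C N W K" using direct_sum_if_Ext1_zero K(2) direct_sum_commute by blast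
  moreover have "(K, L) \<in> Syz"
  proof (rule syzygyI[OF K(1) _ _ L])
    show "E' \<in> \<W>" using direct_sum_in_iff E' E(1) assms(3) unfolding direct_sum_def by blast
    show "K \<in> Perp" using perp1_between_extension[OF K(2)] assms(3) W_subset_Perp N by blast
  qed
  ultimately show ?thesis using syzygy_isomorphic_left direct_sum_isomorphic assms(2) by blast
qed

lemma syzygy_add_summand_right:
  "(K, N) \<in> Syz \<Longrightarrow> direct_sum C N W M \<Longrightarrow> W \<in> \<W> \<Longrightarrow> (K, M) \<in> Syz"
  using syzygy_setting.syzygy_add_summand_left[OF dual_setting, of N K W M] by simp

lemma periodic_points_direct_sum:
  assumes "m \<ge> 1" "direct_sum C N W M" "W \<in> \<W>"
  shows "M \<in> periodic_points Syz m \<longleftrightarrow> N \<in> periodic_points Syz m"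
proof -
  have "(M, M) \<in> Syz ^^ m \<Longrightarrow> (N, N) \<in> Syz ^^ m"
    by (rule relpow_change_ends)
      (use assms syzygy_drop_summand_left syzygy_drop_summand_right in blast)+
  moreover have "(N, N) \<in> Syz ^^ m \<Longrightarrow> (M, M) \<in> Syz ^^ m"
    by (rule relpow_change_ends)
      (use assms syzygy_add_summand_left syzygy_add_summand_right in blast)+
  ultimately show ?thesis by (auto simp: periodic_points_def)
qed

lemma periodic_points_subset_Perp:
  assumes "m \<ge> 1"
  shows "periodic_points Syz m \<subseteq> Perp"
  using periodic_points_predecessor[OF _ assms] syzygyE by (metis subsetI)

lemma periodic_points_successor:
  assumes "M \<in> periodic_points Syz m" "m \<ge> 1"
  obtains N where "N \<in> periodic_points Syz m" "(M, N) \<in> Syz"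
  using periodic_points_predecessor[of M "Syz\<inverse>" m] assms by (auto simp: periodic_points_converse)

lemma kernel_criterion_if_closed_extensions:
  assumes m: "m \<ge> 1" and closed: "closed_extensions C (periodic_points Syz m)"
  shows "kernel_criterion C (periodic_points Syz m) (right_perp1 C \<U>)"
  unfolding kernel_criterion_def
proof (intro allI impI, elim conjE)
  fix X Y Z f g
  assume se: "short_exact C X Y Z f g" and Y: "Y \<in> periodic_points Syz m"
    and Z: "Z \<in> periodic_points Syz m"
  show "X \<in> periodic_points Syz m \<longleftrightarrow> X \<in> right_perp1 C \<U>"
  proof
    show "X \<in> periodic_points Syz m \<Longrightarrow> X \<in> right_perp1 C \<U>"
      using periodic_points_subset_Perp[OF m] by (auto simp: perp1_between_def)
    assume X: "X \<in> right_perp1 C \<U>"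
    obtain N where N: "N \<in> periodic_points Syz m" "(N, Z) \<in> Syz"
      using periodic_points_predecessor[OF Z m] .
    obtain W f' g' where W: "W \<in> \<W>" "short_exact C N W Z f' g'" using syzygyE[OF N(2)] .
    obtain E k q k' q' where E: "short_exact C X E W k q" "short_exact C N E Y k' q'"
      using short_exact_pullback_cross[OF se W(2)] .
    have "Ext1_zero C W X" using X W(1) W_subset_U by (auto simp: right_perp1_def)
    then have "direct_sum C X W E" using direct_sum_if_Ext1_zero E(1) by blast
    moreover have "E \<in> periodic_points Syz m"
      using closed E(2) N(1) Y unfolding closed_extensions_def by blast
    ultimately show "X \<in> periodic_points Syz m" using periodic_points_direct_sum[OF m] W(1) by blast
  qed
qed

lemma closed_extensions_if_kernel_criterion:
  assumes m: "m \<ge> 1" and criterion: "kernel_criterion C (periodic_points Syz m) (right_perp1 C \<U>)"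
  shows "closed_extensions C (periodic_points Syz m)"
  unfolding closed_extensions_def
proof (intro allI impI, elim conjE)
  fix X Y Z f g
  assume se: "short_exact C X Y Z f g" and X: "X \<in> periodic_points Syz m"
    and Z: "Z \<in> periodic_points Syz m"
  have perp: "X \<in> Perp" "Z \<in> Perp" using X Z periodic_points_subset_Perp[OF m] by blast+
  obtain N where N: "N \<in> periodic_points Syz m" "(X, N) \<in> Syz"
    using periodic_points_successor[OF X m] .
  obtain W f' g' where W: "W \<in> \<W>" "short_exact C X W N f' g'" using syzygyE[OF N(2)] .
  obtain E k q k' q' where E: "short_exact C W E Z k q" "short_exact C Y E N k' q'"
    using short_exact_pushout_cross[OF se W(2)] .
  have "Ext1_zero C Z W" using perp(2) W(1) W_subset_V by (auto simp: in_perp1_between_iff)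
  then have "direct_sum C Z W E" using direct_sum_if_Ext1_zero E(1) direct_sum_commute by blast
  then have "E \<in> periodic_points Syz m" using periodic_points_direct_sum[OF m] Z W(1) by blast
  moreover have "Y \<in> right_perp1 C \<U>"
    using perp1_between_extension[OF se perp] by (simp add: perp1_between_def)
  ultimately show "Y \<in> periodic_points Syz m"
    using criterion E(2) N(1) unfolding kernel_criterion_def by blast
qed

lemma closed_extensions_iff_kernel_criterion:
  "m \<ge> 1 \<Longrightarrow> closed_extensions C (periodic_points Syz m) \<longleftrightarrow>
     kernel_criterion C (periodic_points Syz m) (right_perp1 C \<U>)"
  using kernel_criterion_if_closed_extensions closed_extensions_if_kernel_criterion by blast

lemma closed_extensions_iff_cokernel_criterion:
  "m \<ge> 1 \<Longrightarrow> closed_extensions C (periodic_points Syz m) \<longleftrightarrow>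
     cokernel_criterion C (periodic_points Syz m) (left_perp1 C \<V>)"
  using syzygy_setting.closed_extensions_iff_kernel_criterion[OF dual_setting, of m]
  by (simp add: periodic_points_converse)


section \<open>Periodic Gorenstein projective objects\<close>

lemma acyclic_iff_cycles_in_Perp:
  assumes sp: "spliced C X d c k u" and X: "\<And>n. X n \<in> \<W>"
  shows "(\<forall>U\<in>\<U>. hom_from_acyclic C U X d) \<and> (\<forall>V\<in>\<V>. hom_to_acyclic C V X d) \<longleftrightarrow> (\<forall>n. c n \<in> Perp)"
proof -
  have "hom_from_acyclic C U X d \<longleftrightarrow> (\<forall>n. Ext1_zero C U (c n))" if "U \<in> \<U>" for U
    using spliced_hom_from_acyclic_iff_Ext1_zero[OF sp] Ext1_zero_U_W that X by blast
  moreover have "hom_to_acyclic C V X d \<longleftrightarrow> (\<forall>n. Ext1_zero C (c n) V)" if "V \<in> \<V>" for V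
    using spliced_hom_to_acyclic_iff_Ext1_zero[OF sp] Ext1_zero_W_V that X by blast
  moreover have "c n \<in> c_obj C" for n using spliced_in_hom(1)[OF sp, of n] by simp
  ultimately show ?thesis by (auto simp: in_perp1_between_iff)
qed

lemma periodic_point_if_proper_loop:
  assumes m: "m \<ge> 1" and loop: "is_loop C \<W> m M X d"
    and acyclic: "\<forall>U\<in>\<U>. hom_from_acyclic C U X d" "\<forall>V\<in>\<V>. hom_to_acyclic C V X d"
  shows "M \<in> periodic_points Syz m"
proof -
  have X: "\<And>n. X n \<in> \<W>" and cycles: "\<And>i. cycle_iso C X d (i * int m) M"
    and exact: "exact_complex C X d"
    using loop unfolding is_loop_def by blast+
  obtain c k u where sp: "spliced C X d c k u" using exact_complex_spliced[OF exact] .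
  have "c n \<in> Perp" for n using acyclic_iff_cycles_in_Perp[OF sp X] acyclic by blast
  then have "(c n, c (n - 1)) \<in> Syz" for n using syzygyI[OF spliced_short_exact[OF sp] X] by blast
  then have walk: "(c (int m), c 0) \<in> Syz ^^ m" by (rule relpow_if_descending)
  have iso: "isomorphic C M (c (int m))" "isomorphic C M (c 0)"
    using cycles[of 1] cycles[of 0] spliced_cycle_iso_iff[OF sp] isomorphic_sym by simp_all
  have "(M, M) \<in> Syz ^^ m"
    by (rule relpow_change_ends[OF walk m])
      (use syzygy_isomorphic_left syzygy_isomorphic_right iso in blast)+
  then show ?thesis by (simp add: periodic_points_def)
qed

lemma proper_loop_if_periodic_point:
  assumes m: "m \<ge> 1" and M: "M \<in> periodic_points Syz m"
  obtains X d where "is_loop C \<W> m M X d"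
    "\<forall>U\<in>\<U>. hom_from_acyclic C U X d" "\<forall>V\<in>\<V>. hom_to_acyclic C V X d"
proof -
  obtain c :: "int \<Rightarrow> 'o" where c: "\<And>n. (c n, c (n - 1)) \<in> Syz" "\<And>i. c (i * int m) = M"
    using periodic_points_descending[OF M m] by metis
  then have "\<exists>X k u. X \<in> \<W> \<and> c n \<in> Perp \<and> short_exact C (c n) X (c (n - 1)) k u" for n
    using syzygyE by metis
  then obtain X k u where X: "\<And>n. X n \<in> \<W>" and perp: "\<And>n. c n \<in> Perp"
    and se: "\<And>n. short_exact C (c n) (X n) (c (n - 1)) (k n) (u n)"
    by metis
  define d where "d n = k (n - 1) \<cdot> u n" for n
  have sp: "spliced C X d c k u" unfolding spliced_def d_def using se by simp
  have "isomorphic C (c (i * int m)) M" for i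
    using c(2) isomorphic_refl[of M] perp[of 0] c(2)[of 0] by (simp add: in_perp1_between_iff)
  then have "is_loop C \<W> m M X d"
    unfolding is_loop_def using spliced_exact_complex[OF sp] X spliced_cycle_iso_iff[OF sp] by blast
  then show thesis using that acyclic_iff_cycles_in_Perp[OF sp X] perp by blast
qed

end

lemma piGP_ppr_eq_periodic_points:
  assumes "syzygy_setting C \<W> \<W> \<V>" "m \<ge> 1"
  shows "piGP_ppr C \<W> \<V> m = periodic_points (syzygy_rel C \<W> \<W> \<V>) m"
proof -
  interpret syzygy_setting C \<W> \<W> \<V> by fact
  show ?thesis
  proof (intro set_eqI iffI)
    show "M \<in> periodic_points Syz m" if "M \<in> piGP_ppr C \<W> \<V> m" for M
      using periodic_point_if_proper_loop[OF assms(2)] that unfolding piGP_ppr_def by blast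
    show "M \<in> piGP_ppr C \<W> \<V> m" if M: "M \<in> periodic_points Syz m" for M
    proof -
      have "M \<in> c_obj C"
        using periodic_points_subset_Perp[OF assms(2)] M by (auto simp: in_perp1_between_iff)
      moreover obtain X d where "is_loop C \<W> m M X d"
        "\<forall>W\<in>\<W>. hom_from_acyclic C W X d" "\<forall>V\<in>\<V>. hom_to_acyclic C V X d"
        using proper_loop_if_periodic_point[OF assms(2) M] .
      ultimately show ?thesis unfolding piGP_ppr_def by blast
    qed
  qed
qed

lemma syzygy_setting_Int:
  assumes "abelian C" "\<A> \<subseteq> c_obj C" "Ext1_zero_classes C \<A> \<B>"
    and "closed_fin_coproducts C (\<A> \<inter> \<B>)" "closed_summands C (\<A> \<inter> \<B>)"
  shows "syzygy_setting C (\<A> \<inter> \<B>) (\<A> \<inter> \<B>) \<B>"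
proof -
  interpret abelian_category C using assms(1) by unfold_locales
  show ?thesis
  proof
    show "Z \<in> \<A> \<inter> \<B>" if "zero_obj C Z" for Z
      using assms(4) that unfolding closed_fin_coproducts_def by blast
    show "S \<in> \<A> \<inter> \<B> \<longleftrightarrow> A \<in> \<A> \<inter> \<B> \<and> B \<in> \<A> \<inter> \<B>" if "direct_sum C A B S" for A B S
    proof -
      obtain i j where S: "is_coproduct C A B S i j"
        using \<open>direct_sum C A B S\<close> biproduct_coproduct unfolding direct_sum_def by blast
      then have "A \<in> c_obj C" "B \<in> c_obj C" using coproduct_in_hom[OF S] by simp_all
      then show ?thesis
        using assms(4,5) S unfolding closed_fin_coproducts_def closed_summands_def by blast
    qed
  qed (use assms(2,3) in \<open>auto simp: Ext1_zero_classes_def\<close>)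
qed

theorem theorem5p3:
  fixes C :: "('o,'m) category" and \<A> \<B> :: "'o set" and m :: nat
  assumes "abelian C"
    and "m \<ge> 1"
    and "\<A> \<subseteq> c_obj C" and "\<B> \<subseteq> c_obj C"
    and "Ext1_zero_classes C \<A> \<B>"
    and "closed_fin_coproducts C (\<A> \<inter> \<B>)"
    and "closed_summands C (\<A> \<inter> \<B>)"
  shows
   "(\<forall>M N W i j. N \<in> c_obj C \<and> W \<in> \<A> \<inter> \<B> \<and> is_coproduct C N W M i j \<longrightarrow>
        (M \<in> piGP_ppr C (\<A> \<inter> \<B>) \<B> m \<longleftrightarrow> N \<in> piGP_ppr C (\<A> \<inter> \<B>) \<B> m))
    \<and>
    (let P = piGP_ppr C (\<A> \<inter> \<B>) \<B> m in
     ((\<forall>X Y Z f g. short_exact C X Y Z f g \<and> X \<in> P \<and> Z \<in> P \<longrightarrow> Y \<in> P)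
      \<longleftrightarrow>
      (\<forall>X Y Z f g. short_exact C X Y Z f g \<and> Y \<in> P \<and> Z \<in> P \<longrightarrow>
         (X \<in> P \<longleftrightarrow> X \<in> right_perp1 C (\<A> \<inter> \<B>))))
     \<and>
     ((\<forall>X Y Z f g. short_exact C X Y Z f g \<and> X \<in> P \<and> Z \<in> P \<longrightarrow> Y \<in> P)
      \<longleftrightarrow>
      (\<forall>X Y Z f g. short_exact C X Y Z f g \<and> X \<in> P \<and> Y \<in> P \<longrightarrow>
         (Z \<in> P \<longleftrightarrow> Z \<in> left_perp1 C \<B>))))"
proof -
  have setting: "syzygy_setting C (\<A> \<inter> \<B>) (\<A> \<inter> \<B>) \<B>"
    using syzygy_setting_Int assms by blast
  then interpret syzygy_setting C "\<A> \<inter> \<B>" "\<A> \<inter> \<B>" \<B> .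
  have summand: "\<forall>M N W i j. N \<in> c_obj C \<and> W \<in> \<A> \<inter> \<B> \<and> is_coproduct C N W M i j \<longrightarrow>
      (M \<in> periodic_points Syz m \<longleftrightarrow> N \<in> periodic_points Syz m)"
    using periodic_points_direct_sum[OF assms(2)] direct_sum_if_coproduct by blast
  show ?thesis
    unfolding piGP_ppr_eq_periodic_points[OF setting assms(2)] Let_def
    using summand closed_extensions_iff_kernel_criterion[OF assms(2)]
      closed_extensions_iff_cokernel_criterion[OF assms(2)]
    unfolding closed_extensions_def kernel_criterion_def cokernel_criterion_def by (intro conjI)
qed

end
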